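(* Let $M$ be a compact oriented Riemannian manifold with uniform measure $\mu$. Let $t_1,\dots,t_m:M\to\mathbb{R}$ be twice continuously differentiable functions such that the constant function $1$ and $t_1,\dots,t_m$ are linearly independent on $M$. For $\pi\in\mathbb{R}^m$ let $f(x;\pi)\propto\exp\{\pi^Tt(x)\}$, $t=(t_1,\dots,t_m)^T$, be the corresponding probability density with respect to $\mu$. Fix $\pi_0\in\mathbb{R}^m$, let $E$ denote expectation for a random point $x$ of $M$ with density $f(\cdot;\pi_0)$, and define the $m\times m$ matrix $W$ and the $m$-vector $d$ by $$W_{\ell_1\ell_2}=E\{\langle t_{\ell_1},t_{\ell_2}\rangle(x)\},\qquad d_\ell=-E\{\Delta_Mt_\ell(x)\}.$$ Then $W$ is nonsingular and $\pi_0=W^{-1}d$.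
   Context: In local coordinates $x=(x_1,\dots,x_p)$ with metric tensor $G(x)=(g_{ij}(x))$ and inverse $G^{-1}(x)=(g^{ij}(x))$: the uniform measure is $\mu(dx)=\{\det G(x)\}^{1/2}dx$; for real functions $u,v$ on $M$, the gradient inner product is the function $\langle u,v\rangle(x)=(\nabla u)^TG^{-1}(\nabla v)$, where $\nabla u=(\partial u/\partial x_j)_{j=1,\dots,p}$ is the column vector of partial derivatives; the Laplace-Beltrami operator is $$\Delta_M u=\sum_{i,j=1}^p\{\det G\}^{-1/2}\frac{\partial}{\partial x_i}\left[\{\det G\}^{1/2}g^{ij}\frac{\partial u}{\partial x_j}\right].$$ These are independent of the choice of local coordinates.
   Formalization: The manifold M is additionally assumed connected; otherwise the claim fails: on two disjoint circles with m = 1 and t the indicator of one circle, 1 and t are linearly independent but the gradient of t vanishes, so W = 0. *)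

theory Defs
  imports "HOL-Analysis.Analysis"
begin

section \<open>Calculus on open subsets of Euclidean space\<close>

definition partial :: "'p \<Rightarrow> (real ^ 'p \<Rightarrow> real) \<Rightarrow> real ^ 'p \<Rightarrow> real" where
  "partial j f x = deriv (\<lambda>s. f (x + s *\<^sub>R axis j 1)) 0"

(* f is of class C^k on S; meant for open S only. *)
primrec Ck_on :: "nat \<Rightarrow> (real ^ 'p \<Rightarrow> real) \<Rightarrow> (real ^ 'p) set \<Rightarrow> bool" where
  "Ck_on 0 f S \<longleftrightarrow> continuous_on S f"
| "Ck_on (Suc k) f S \<longleftrightarrow> f differentiable_on S \<and> (\<forall>j. Ck_on k (partial j f) S)"

definition smooth_on :: "(real ^ 'p \<Rightarrow> real) \<Rightarrow> (real ^ 'p) set \<Rightarrow> bool" where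
  "smooth_on f S \<longleftrightarrow> (\<forall>k. Ck_on k f S)"


section \<open>Manifolds\<close>

(* A chart is a domain together with a coordinate map. The coordinate map is a total function
   whose values outside the domain are irrelevant. *)
type_synonym ('a, 'p) chart = "'a set \<times> ('a \<Rightarrow> real ^ 'p)"

abbreviation chart_dom :: "('a, 'p::finite) chart \<Rightarrow> 'a set" where
  "chart_dom c \<equiv> fst c"

abbreviation coord :: "('a, 'p::finite) chart \<Rightarrow> 'a \<Rightarrow> real ^ 'p" where
  "coord c \<equiv> snd c"

definition chart_codom :: "('a, 'p::finite) chart \<Rightarrow> (real ^ 'p) set" where
  "chart_codom c = coord c ` chart_dom c"

definition param :: "('a, 'p::finite) chart \<Rightarrow> real ^ 'p \<Rightarrow> 'a" where
  "param c = inv_into (chart_dom c) (coord c)"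

definition transition :: "('a, 'p::finite) chart \<Rightarrow> ('a, 'p) chart \<Rightarrow> real ^ 'p \<Rightarrow> real ^ 'p" where
  "transition c c' = coord c' \<circ> param c"

definition overlap :: "('a, 'p::finite) chart \<Rightarrow> ('a, 'p) chart \<Rightarrow> (real ^ 'p) set" where
  "overlap c c' = coord c ` (chart_dom c \<inter> chart_dom c')"

(* C-infinity manifolds without boundary, of dimension CARD('p). The atlas need not be maximal. *)
locale smooth_manifold =
  fixes X :: "'a topology" and A :: "('a, 'p::finite) chart set"
  assumes Hausdorff: "Hausdorff_space X"
    and second_countable: "second_countable X"
    and cover: "(\<Union>c\<in>A. chart_dom c) = topspace X"
    and open_dom: "c \<in> A \<Longrightarrow> openin X (chart_dom c)"
    and open_codom: "c \<in> A \<Longrightarrow> open (chart_codom c)"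
    and homeomorphic: "c \<in> A \<Longrightarrow>
      homeomorphic_map (subtopology X (chart_dom c)) (top_of_set (chart_codom c)) (coord c)"
    and compatible: "c \<in> A \<Longrightarrow> c' \<in> A \<Longrightarrow>
      smooth_on (\<lambda>y. transition c c' y $ i) (overlap c c')"

locale oriented_manifold = smooth_manifold X A
  for X :: "'a topology" and A :: "('a, 'p::finite) chart set" +
  assumes orientation: "c \<in> A \<Longrightarrow> c' \<in> A \<Longrightarrow> y \<in> overlap c c' \<Longrightarrow>
    det (jacobian (transition c c') (at y)) > 0"

(* The metric is given by its coordinate expressions: G c y is the matrix of the metric tensor
   in the chart c at the point with coordinates y. *)
locale oriented_riemannian_manifold = oriented_manifold X A
  for X :: "'a topology" and A :: "('a, 'p::finite) chart set" +
  fixes G :: "('a, 'p) chart \<Rightarrow> real ^ 'p \<Rightarrow> real ^ 'p ^ 'p"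
  assumes metric_smooth: "c \<in> A \<Longrightarrow> smooth_on (\<lambda>y. G c y $ i $ j) (chart_codom c)"
    and metric_symmetric: "c \<in> A \<Longrightarrow> y \<in> chart_codom c \<Longrightarrow> transpose (G c y) = G c y"
    and metric_positive: "c \<in> A \<Longrightarrow> y \<in> chart_codom c \<Longrightarrow> v \<noteq> 0 \<Longrightarrow> v \<bullet> (G c y *v v) > 0"
    and metric_tensorial: "c \<in> A \<Longrightarrow> c' \<in> A \<Longrightarrow> y \<in> overlap c c' \<Longrightarrow>
      G c y = transpose (jacobian (transition c c') (at y)) ** G c' (transition c c' y)
                ** jacobian (transition c c') (at y)"

locale compact_oriented_riemannian_manifold = oriented_riemannian_manifold X A G
  for X :: "'a topology" and A :: "('a, 'p::finite) chart set"
    and G :: "('a, 'p) chart \<Rightarrow> real ^ 'p \<Rightarrow> real ^ 'p ^ 'p" +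
  assumes compact: "compact_space X"

definition Ck_manifold :: "nat \<Rightarrow> ('a, 'p::finite) chart set \<Rightarrow> ('a \<Rightarrow> real) \<Rightarrow> bool" where
  "Ck_manifold k A u \<longleftrightarrow> (\<forall>c\<in>A. Ck_on k (u \<circ> param c) (chart_codom c))"


section \<open>Riemannian volume, gradient inner product, Laplace-Beltrami operator\<close>

(* The Borel measure on X given in every chart by (det G)^(1/2) dx. *)
definition uniform_measure_on ::
    "'a topology \<Rightarrow> ('a, 'p::finite) chart set \<Rightarrow> (('a, 'p) chart \<Rightarrow> real ^ 'p \<Rightarrow> real ^ 'p ^ 'p)
      \<Rightarrow> 'a measure \<Rightarrow> bool" where
  "uniform_measure_on X A G \<mu> \<longleftrightarrow>
     space \<mu> = topspace X \<and>
     sets \<mu> = sigma_sets (topspace X) {U. openin X U} \<and>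
     (\<forall>c\<in>A. \<forall>B\<in>sets \<mu>. B \<subseteq> chart_dom c \<longrightarrow>
        emeasure \<mu> B = (\<integral>\<^sup>+y\<in>coord c ` B. ennreal (sqrt (det (G c y))) \<partial>lborel))"

definition nabla :: "(real ^ 'p \<Rightarrow> real) \<Rightarrow> real ^ 'p \<Rightarrow> real ^ 'p" where
  "nabla v y = (\<chi> j. partial j v y)"

definition local_grad_inner ::
    "(real ^ 'p \<Rightarrow> real ^ 'p ^ 'p) \<Rightarrow> (real ^ 'p \<Rightarrow> real) \<Rightarrow> (real ^ 'p \<Rightarrow> real) \<Rightarrow> real ^ 'p \<Rightarrow> real" where
  "local_grad_inner g u v y = nabla u y \<bullet> (matrix_inv (g y) *v nabla v y)"

definition local_laplacian ::
    "(real ^ 'p \<Rightarrow> real ^ 'p ^ 'p) \<Rightarrow> (real ^ 'p \<Rightarrow> real) \<Rightarrow> real ^ 'p \<Rightarrow> real" where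
  "local_laplacian g u y =
     (\<Sum>i\<in>UNIV. \<Sum>j\<in>UNIV. 1 / sqrt (det (g y)) *
        partial i (\<lambda>z. sqrt (det (g z)) * matrix_inv (g z) $ i $ j * partial j u z) y)"

(* The local expressions do not depend on the chart, so an arbitrary chart around x is used. *)
definition chart_at :: "('a, 'p::finite) chart set \<Rightarrow> 'a \<Rightarrow> ('a, 'p) chart" where
  "chart_at A x = (SOME c. c \<in> A \<and> x \<in> chart_dom c)"

definition grad_inner ::
    "('a, 'p::finite) chart set \<Rightarrow> (('a, 'p) chart \<Rightarrow> real ^ 'p \<Rightarrow> real ^ 'p ^ 'p)
      \<Rightarrow> ('a \<Rightarrow> real) \<Rightarrow> ('a \<Rightarrow> real) \<Rightarrow> 'a \<Rightarrow> real" where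
  "grad_inner A G u v x =
     (let c = chart_at A x
      in local_grad_inner (G c) (u \<circ> param c) (v \<circ> param c) (coord c x))"

definition laplace_beltrami ::
    "('a, 'p::finite) chart set \<Rightarrow> (('a, 'p) chart \<Rightarrow> real ^ 'p \<Rightarrow> real ^ 'p ^ 'p)
      \<Rightarrow> ('a \<Rightarrow> real) \<Rightarrow> 'a \<Rightarrow> real" where
  "laplace_beltrami A G u x =
     (let c = chart_at A x in local_laplacian (G c) (u \<circ> param c) (coord c x))"


section \<open>Exponential families\<close>

definition lin_indep_funs :: "'a set \<Rightarrow> ('i::finite \<Rightarrow> 'a \<Rightarrow> real) \<Rightarrow> bool" where
  "lin_indep_funs S h \<longleftrightarrow>
     (\<forall>b. (\<forall>x\<in>S. (\<Sum>i\<in>UNIV. b i * h i x) = 0) \<longrightarrow> (\<forall>i. b i = 0))"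

definition exp_density :: "'a measure \<Rightarrow> ('a \<Rightarrow> real ^ 'm) \<Rightarrow> real ^ 'm \<Rightarrow> 'a \<Rightarrow> real" where
  "exp_density \<mu> t \<pi> x = exp (\<pi> \<bullet> t x) / (\<integral>y. exp (\<pi> \<bullet> t y) \<partial>\<mu>)"

definition exp_expectation ::
    "'a measure \<Rightarrow> ('a \<Rightarrow> real ^ 'm) \<Rightarrow> real ^ 'm \<Rightarrow> ('a \<Rightarrow> real) \<Rightarrow> real" where
  "exp_expectation \<mu> t \<pi> h = (\<integral>x. h x \<partial>density \<mu> (\<lambda>y. ennreal (exp_density \<mu> t \<pi> y)))"

end

theory Submission
  imports Defs
begin

text \<open>
  Write \<open>w = exp (\<pi>0 \<bullet> t)\<close> for the unnormalised density. Both claims come from Green's identity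
  \<open>\<integral> \<psi> \<Delta>u d\<mu> + \<integral> \<langle>\<psi>, u\<rangle> d\<mu> = 0\<close> on a closed manifold (\<open>green_identity\<close>). For \<open>\<psi> = w\<close>, \<open>u = t\<^sub>l\<close> the chain rule
  \<open>\<nabla>w = w \<Sum>\<^sub>k \<pi>0\<^sub>k \<nabla>t\<^sub>k\<close> turns it into the \<open>l\<close>-th row of \<open>W \<pi>0 = d\<close>. The matrix \<open>W\<close> is positive definite:
  \<open>b \<bullet> W b\<close> is the expectation of \<open>\<langle>v, v\<rangle> \<ge> 0\<close> for \<open>v = b \<bullet> t\<close>, and if that expectation vanishes then so
  does the gradient of \<open>v\<close>, since \<open>\<langle>v, v\<rangle>\<close> is continuous and \<open>\<mu>\<close> charges every nonempty open set
  (\<open>integral_zero_imp_zero\<close>). Connectedness then makes \<open>v\<close> constant (\<open>locally_constant_imp_constant\<close>), and the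
  linear independence of \<open>1, t\<^sub>1, \<dots>, t\<^sub>m\<close> forces \<open>b = 0\<close>.

  Green's identity is proved first for \<open>\<psi>\<close> supported in one chart (\<open>green_chart\<close>), where it says that the
  divergence of the compactly supported field \<open>\<psi> (det G)\<^sup>1\<^sup>/\<^sup>2 G\<^sup>-\<^sup>1 \<nabla>u\<close> on Euclidean space integrates to zero; that in
  turn is the translation invariance of Lebesgue measure (\<open>integral_partial_compact_support\<close>). A
  partition of unity gives the global statement, once the Laplacian is known to be independent of the
  chart. This independence is read off from the chart version itself instead of being computed: the
  gradient inner product is chart independent by the chain rule, so on an overlap of two charts
  both coordinate Laplacians have the same integral against every bump function, and being continuous
  they agree (\<open>chart_laplacian_le\<close>, \<open>laplace_beltrami_chart\<close>).
\<close>


section \<open>Continuously differentiable functions\<close>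

text \<open>
  The gradient is required at full neighbourhoods (\<open>at x\<close>, not \<open>at x within S\<close>), which is what the
  partial derivatives taken along lines refer to. Stating the class through \<open>GDERIV\<close> makes its closure
  properties immediate from the differentiation rules for gradients.
\<close>

definition C1_on :: "(real ^ 'p) set \<Rightarrow> (real ^ 'p::finite \<Rightarrow> real) \<Rightarrow> bool" where
  "C1_on S f \<longleftrightarrow> (\<exists>g. continuous_on S g \<and> (\<forall>x\<in>S. GDERIV f x :> g x))"

lemma C1_onI:
  "continuous_on S g \<Longrightarrow> (\<And>x. x \<in> S \<Longrightarrow> GDERIV f x :> g x) \<Longrightarrow> C1_on S f"
  unfolding C1_on_def by blast

lemma GDERIV_imp_partial:
  assumes "GDERIV f x :> g"
  shows "partial j f x = g $ j"
proof -
  have "(f has_derivative (\<lambda>h. h \<bullet> g)) (at x)"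
    using assms by (simp add: gderiv_def)
  then have 0: "(f has_derivative (\<lambda>h. h \<bullet> g)) (at (x + 0 *\<^sub>R axis j 1))"
    by simp
  have "((\<lambda>s. f (x + s *\<^sub>R axis j 1)) has_derivative (\<lambda>s. (s *\<^sub>R axis j 1) \<bullet> g)) (at 0)"
    by (rule has_derivative_compose[where f = "\<lambda>s. x + s *\<^sub>R axis j 1", OF _ 0])
       (auto intro!: derivative_eq_intros)
  moreover have "(\<lambda>s. (s *\<^sub>R axis j 1) \<bullet> g) = (*) (g $ j)"
    by (auto simp: inner_axis' fun_eq_iff)
  ultimately have "DERIV (\<lambda>s. f (x + s *\<^sub>R axis j 1)) 0 :> g $ j"
    by (simp add: has_field_derivative_def)
  then show ?thesis
    unfolding partial_def by (rule DERIV_imp_deriv)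
qed

lemma GDERIV_imp_nabla: "GDERIV f x :> g \<Longrightarrow> nabla f x = g"
  by (simp add: nabla_def vec_eq_iff GDERIV_imp_partial)

lemma C1_on_GDERIV: "C1_on S f \<Longrightarrow> x \<in> S \<Longrightarrow> GDERIV f x :> nabla f x"
  unfolding C1_on_def using GDERIV_imp_nabla by metis

lemma C1_on_continuous_nabla: "C1_on S f \<Longrightarrow> continuous_on S (nabla f)"
  unfolding C1_on_def using GDERIV_imp_nabla continuous_on_cong by metis

lemma C1_on_continuous_partial: "C1_on S f \<Longrightarrow> continuous_on S (partial j f)"
  using continuous_on_component[OF C1_on_continuous_nabla, of S f j] by (simp add: nabla_def)

lemma C1_on_continuous:
  assumes "C1_on S f" shows "continuous_on S f"
proof (rule differentiable_imp_continuous_on, unfold differentiable_on_def, rule ballI)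
  fix x assume "x \<in> S"
  then have "(f has_derivative (\<lambda>h. h \<bullet> nabla f x)) (at x)"
    using C1_on_GDERIV[OF assms] by (simp add: gderiv_def)
  then show "f differentiable at x within S"
    using differentiableI differentiable_at_withinI by blast
qed

lemma C1_on_subset: "C1_on T f \<Longrightarrow> S \<subseteq> T \<Longrightarrow> C1_on S f"
  unfolding C1_on_def by (meson continuous_on_subset subsetD)

lemma C1_on_Un:
  assumes "C1_on S f" "C1_on T f" "open S" "open T"
  shows "C1_on (S \<union> T) f"
  using assms
  by (intro C1_onI[of _ "nabla f"] continuous_on_open_Un)
     (auto intro: C1_on_continuous_nabla C1_on_GDERIV)

lemma GDERIV_transform_open:
  assumes "GDERIV f x :> g" "open S" "x \<in> S" "\<And>y. y \<in> S \<Longrightarrow> f y = f' y"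
  shows "GDERIV f' x :> g"
  using assms unfolding gderiv_def by (rule has_derivative_transform_within_open)

lemma C1_on_cong:
  assumes "open S" "\<And>x. x \<in> S \<Longrightarrow> f x = f' x" "C1_on S f"
  shows "C1_on S f'"
  using assms unfolding C1_on_def by (metis GDERIV_transform_open)

lemma nabla_cong_open:
  assumes "C1_on S f" "open S" "x \<in> S" "\<And>y. y \<in> S \<Longrightarrow> f y = f' y"
  shows "nabla f' x = nabla f x"
  using GDERIV_imp_nabla[OF GDERIV_transform_open] C1_on_GDERIV assms by metis

lemma partial_cong_open:
  assumes "open S" "x \<in> S" "\<And>y. y \<in> S \<Longrightarrow> f y = f' y"
  shows "partial j f x = partial j f' x"
proof -
  have "\<forall>\<^sub>F s in nhds 0. x + s *\<^sub>R axis j 1 \<in> S"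
  proof -
    have "((\<lambda>s. x + s *\<^sub>R axis j 1) \<longlongrightarrow> x + 0 *\<^sub>R axis j 1) (nhds (0::real))"
      by (intro tendsto_intros filterlim_ident)
    then show ?thesis
      using assms(1,2) by (auto simp: tendsto_def)
  qed
  then have "\<forall>\<^sub>F s in nhds 0. f (x + s *\<^sub>R axis j 1) = f' (x + s *\<^sub>R axis j 1)"
    by (rule eventually_mono) (rule assms(3))
  then show ?thesis
    unfolding partial_def by (rule deriv_cong_ev) simp
qed

lemma C1_on_const [intro]: "C1_on S (\<lambda>x. k)"
  by (rule C1_onI[of _ "\<lambda>_. 0"]) (auto intro: GDERIV_const)

lemma C1_on_add:
  assumes "C1_on S f" "C1_on S g" shows "C1_on S (\<lambda>x. f x + g x)"
  using assms
  by (intro C1_onI[of _ "\<lambda>x. nabla f x + nabla g x"] continuous_intros GDERIV_add)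
     (auto intro: C1_on_continuous_nabla C1_on_GDERIV)

lemma C1_on_mult:
  assumes "C1_on S f" "C1_on S g" shows "C1_on S (\<lambda>x. f x * g x)"
  using assms
  by (intro C1_onI[of _ "\<lambda>x. f x *\<^sub>R nabla g x + g x *\<^sub>R nabla f x"] continuous_intros GDERIV_mult)
     (auto intro: C1_on_continuous_nabla C1_on_GDERIV C1_on_continuous)

lemma C1_on_sum: "(\<And>i. i \<in> I \<Longrightarrow> C1_on S (f i)) \<Longrightarrow> C1_on S (\<lambda>x. \<Sum>i\<in>I. f i x)"
  by (induction I rule: infinite_finite_induct) (auto intro: C1_on_add)

lemma C1_on_prod: "(\<And>i. i \<in> I \<Longrightarrow> C1_on S (f i)) \<Longrightarrow> C1_on S (\<lambda>x. \<Prod>i\<in>I. f i x)"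
  by (induction I rule: infinite_finite_induct) (auto intro: C1_on_mult)

lemma C1_on_DERIV_compose:
  assumes "C1_on S f" "\<And>x. x \<in> S \<Longrightarrow> DERIV h (f x) :> h' (f x)" "continuous_on (f ` S) h'"
  shows "C1_on S (\<lambda>x. h (f x))"
proof (rule C1_onI)
  show "continuous_on S (\<lambda>x. h' (f x) *\<^sub>R nabla f x)"
    using assms
    by (intro continuous_intros continuous_on_compose2[OF assms(3)] C1_on_continuous C1_on_continuous_nabla)
       auto
qed (use assms in \<open>auto intro: GDERIV_DERIV_compose C1_on_GDERIV\<close>)

lemma C1_on_inverse:
  assumes "C1_on S f" "\<And>x. x \<in> S \<Longrightarrow> f x \<noteq> 0" shows "C1_on S (\<lambda>x. inverse (f x))"
proof (rule C1_on_DERIV_compose[of S f inverse "\<lambda>y. - (inverse y)\<^sup>2"])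
  show "\<And>x. x \<in> S \<Longrightarrow> DERIV inverse (f x) :> - (inverse (f x))\<^sup>2"
    using DERIV_inverse assms(2) by (metis numeral_2_eq_2)
  show "continuous_on (f ` S) (\<lambda>y. - (inverse y)\<^sup>2)"
    using assms(2) by (auto intro!: continuous_intros)
qed (fact assms)

lemma C1_on_divide:
  assumes "C1_on S f" "C1_on S g" "\<And>x. x \<in> S \<Longrightarrow> g x \<noteq> 0"
  shows "C1_on S (\<lambda>x. f x / g x)"
  unfolding divide_inverse by (intro C1_on_mult C1_on_inverse assms)

lemma C1_on_exp: "C1_on S f \<Longrightarrow> C1_on S (\<lambda>x. exp (f x))"
  by (rule C1_on_DERIV_compose[of S f exp exp]) (auto intro!: continuous_intros)

lemma C1_on_sqrt:
  assumes "C1_on S f" "\<And>x. x \<in> S \<Longrightarrow> f x > 0" shows "C1_on S (\<lambda>x. sqrt (f x))"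
proof (rule C1_on_DERIV_compose[of S f sqrt "\<lambda>y. inverse (sqrt y) / 2"])
  show "continuous_on (f ` S) (\<lambda>y. inverse (sqrt y) / 2)"
    using assms(2) by (fastforce intro!: continuous_intros)
qed (use assms in \<open>auto intro: DERIV_real_sqrt\<close>)

lemma nabla_add:
  assumes "C1_on S f" "C1_on S g" "x \<in> S"
  shows "nabla (\<lambda>x. f x + g x) x = nabla f x + nabla g x"
  using assms by (intro GDERIV_imp_nabla GDERIV_add C1_on_GDERIV)

lemma nabla_mult:
  assumes "C1_on S f" "C1_on S g" "x \<in> S"
  shows "nabla (\<lambda>x. f x * g x) x = f x *\<^sub>R nabla g x + g x *\<^sub>R nabla f x"
  using assms by (intro GDERIV_imp_nabla GDERIV_mult C1_on_GDERIV)

lemma partial_mult: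
  assumes "C1_on S f" "C1_on S g" "x \<in> S"
  shows "partial i (\<lambda>x. f x * g x) x = f x * partial i g x + g x * partial i f x"
  using arg_cong[OF nabla_mult[OF assms], of "\<lambda>v. v $ i"] by (simp add: nabla_def)

lemma nabla_exp:
  assumes "C1_on S f" "x \<in> S"
  shows "nabla (\<lambda>x. exp (f x)) x = exp (f x) *\<^sub>R nabla f x"
  using assms by (intro GDERIV_imp_nabla GDERIV_DERIV_compose C1_on_GDERIV DERIV_exp)

lemma nabla_const: "nabla (\<lambda>x. k) x = 0"
  by (intro GDERIV_imp_nabla GDERIV_const)

lemma Ck_on_1_imp_C1_on:
  assumes "Ck_on 1 f S" "open S"
  shows "C1_on S f"
proof (rule C1_onI)
  have *: "f differentiable_on S" "\<And>j. continuous_on S (partial j f)"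
    using assms(1) by auto
  show "continuous_on S (nabla f)"
    unfolding nabla_def by (intro continuous_on_vec_lambda *)
  fix x assume x: "x \<in> S"
  then have "f differentiable at x"
    using *(1) assms(2) by (simp add: differentiable_on_eq_differentiable_at)
  then obtain f' where f': "(f has_derivative f') (at x)"
    by (auto simp: differentiable_def)
  define g where "g = (\<chi> j. f' (axis j 1))"
  have "f' h = h \<bullet> g" for h
  proof -
    have "f' h = f' (\<Sum>j\<in>UNIV. h $ j *\<^sub>R axis j 1)"
      by (simp add: basis_expansion[of h, unfolded scalar_mult_eq_scaleR])
    also have "\<dots> = (\<Sum>j\<in>UNIV. h $ j * f' (axis j 1))"
      using has_derivative_linear[OF f'] by (simp add: linear_sum linear_cmul)
    finally show ?thesis
      by (simp add: inner_vec_def g_def)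
  qed
  then have "GDERIV f x :> g"
    using f' unfolding gderiv_def by presburger
  then show "GDERIV f x :> nabla f x"
    using GDERIV_imp_nabla by metis
qed

lemma Ck_on_2_imp_C1_on:
  assumes "Ck_on 2 f S" "open S"
  shows "C1_on S f" "C1_on S (partial j f)"
proof -
  have *: "f differentiable_on S" "\<And>j. Ck_on 1 (partial j f) S"
    using assms(1) by (auto simp: numeral_2_eq_2)
  show p: "C1_on S (partial j f)" for j
    using *(2) assms(2) by (rule Ck_on_1_imp_C1_on)
  show "C1_on S f"
    using *(1) C1_on_continuous[OF p] assms(2) by (intro Ck_on_1_imp_C1_on) auto
qed

lemma smooth_on_imp_C1_on: "smooth_on f S \<Longrightarrow> open S \<Longrightarrow> C1_on S f"
  unfolding smooth_on_def using Ck_on_1_imp_C1_on by blast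

lemma has_derivative_C1_components:
  fixes F :: "real ^ 'p::finite \<Rightarrow> real ^ 'q::finite"
  assumes "\<And>i. C1_on S (\<lambda>y. F y $ i)" "x \<in> S"
  shows "(F has_derivative (\<lambda>h. jacobian F (at x) *v h)) (at x)"
proof -
  have "(F has_derivative (\<lambda>h. \<chi> i. h \<bullet> nabla (\<lambda>y. F y $ i) x)) (at x)"
    unfolding has_derivative_componentwise_within[of F]
  proof
    fix b :: "real ^ 'q" assume "b \<in> Basis"
    then obtain i where b: "b = axis i 1"
      by (auto simp: Basis_vec_def)
    have "GDERIV (\<lambda>y. F y $ i) x :> nabla (\<lambda>y. F y $ i) x"
      by (rule C1_on_GDERIV[OF assms])
    then show "((\<lambda>x. F x \<bullet> b) has_derivative (\<lambda>h. (\<chi> i. h \<bullet> nabla (\<lambda>y. F y $ i) x) \<bullet> b)) (at x)"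
      by (simp add: b inner_axis gderiv_def)
  qed
  then have "F differentiable at x"
    by (rule differentiableI)
  then show ?thesis
    by (simp add: jacobian_works)
qed

lemma GDERIV_compose_jacobian:
  fixes F :: "real ^ 'p::finite \<Rightarrow> real ^ 'q::finite"
  assumes "(F has_derivative (\<lambda>h. J *v h)) (at x)" "GDERIV f (F x) :> g"
  shows "GDERIV (\<lambda>y. f (F y)) x :> transpose J *v g"
proof -
  have "((\<lambda>y. f (F y)) has_derivative (\<lambda>h. (J *v h) \<bullet> g)) (at x)"
    using has_derivative_compose[OF assms(1), of f "\<lambda>h. h \<bullet> g"] assms(2) by (simp add: gderiv_def)
  moreover have "(J *v h) \<bullet> g = h \<bullet> (transpose J *v g)" for h
    by (metis dot_lmul_matrix inner_commute vector_transpose_matrix transpose_transpose)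
  ultimately show ?thesis
    by (simp add: gderiv_def)
qed

text \<open>
  Continuity of the gradient of \<open>f \<circ> F\<close> is the continuity of the entries of the Jacobian of \<open>F\<close>, which are
  the partial derivatives of the components.
\<close>

lemma C1_on_compose:
  fixes F :: "real ^ 'p::finite \<Rightarrow> real ^ 'q::finite"
  assumes F: "\<And>i. C1_on S (\<lambda>y. F y $ i)" and f: "C1_on T f" and "F ` S \<subseteq> T"
  shows "C1_on S (\<lambda>y. f (F y))"
proof (rule C1_onI)
  have J: "jacobian F (at y) $ i $ j = partial j (\<lambda>y. F y $ i) y" if "y \<in> S" for y i j
  proof -
    have "((\<lambda>y. F y $ i) has_derivative (\<lambda>h. (jacobian F (at y) *v h) $ i)) (at y)"
      using bounded_linear.has_derivative[OF bounded_linear_vec_nth has_derivative_C1_components[OF F that]] .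
    then have "GDERIV (\<lambda>y. F y $ i) y :> (jacobian F (at y) $ i)"
      unfolding gderiv_def by (simp add: matrix_vector_mul_component inner_commute)
    then show ?thesis
      by (simp add: GDERIV_imp_partial)
  qed
  have cF: "continuous_on S F"
    using continuous_on_vec_lambda[of S "\<lambda>i y. F y $ i"] C1_on_continuous[OF F] by simp
  have "continuous_on S (\<lambda>y. \<chi> j. \<Sum>i\<in>UNIV. partial j (\<lambda>y. F y $ i) y * nabla f (F y) $ i)"
    using assms(3)
    by (intro continuous_on_vec_lambda continuous_intros C1_on_continuous_partial F
        continuous_on_compose2[OF C1_on_continuous_nabla[OF f] cF]) 
  then show "continuous_on S (\<lambda>y. transpose (jacobian F (at y)) *v nabla f (F y))"
    by (rule continuous_on_eq) (simp add: matrix_vector_mult_def transpose_def J)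
  fix y assume y: "y \<in> S"
  show "GDERIV (\<lambda>y. f (F y)) y :> transpose (jacobian F (at y)) *v nabla f (F y)"
    using y assms(3) 
    by (intro GDERIV_compose_jacobian has_derivative_C1_components[OF F] C1_on_GDERIV[OF f]) auto
qed

section \<open>Positive definite matrices\<close>

lemma matrix_inv_right_left:
  fixes M :: "real ^ 'n::finite ^ 'n"
  assumes "invertible M"
  shows "M ** matrix_inv M = mat 1" "matrix_inv M ** M = mat 1"
  using someI_ex[OF assms[unfolded invertible_def]] unfolding matrix_inv_def by auto

lemma matrix_inv_unique:
  fixes M :: "real ^ 'n::finite ^ 'n"
  assumes "M ** N = mat 1"
  shows "matrix_inv M = N"
proof -
  have "invertible M"
    using assms matrix_left_right_inverse unfolding invertible_def by blast
  then have "matrix_inv M ** M ** N = N"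
    by (simp add: matrix_inv_right_left)
  then show ?thesis
    using assms by (simp add: matrix_mul_assoc[symmetric])
qed

lemma positive_definite_invertible:
  fixes M :: "real ^ 'n::finite ^ 'n"
  assumes "\<And>v. v \<noteq> 0 \<Longrightarrow> v \<bullet> (M *v v) > 0"
  shows "invertible M"
proof -
  have "\<exists>B. B ** M = mat 1"
    unfolding matrix_left_invertible_ker using assms by (metis inner_zero_right less_irrefl)
  then show ?thesis
    using matrix_left_right_inverse unfolding invertible_def by blast
qed

lemma continuous_on_det:
  fixes M :: "'a::topological_space \<Rightarrow> real ^ 'n::finite ^ 'n"
  assumes "\<And>i j. continuous_on S (\<lambda>x. M x $ i $ j)"
  shows "continuous_on S (\<lambda>x. det (M x))"
  unfolding det_def by (intro continuous_intros assms)

text \<open>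
  The segment from the identity to \<open>M\<close> consists of positive definite, hence nonsingular, matrices, so the
  determinant keeps the sign it has at the identity.
\<close>

lemma positive_definite_det_pos:
  fixes M :: "real ^ 'n::finite ^ 'n"
  assumes pd: "\<And>v. v \<noteq> 0 \<Longrightarrow> v \<bullet> (M *v v) > 0"
  shows "det M > 0"
proof (rule ccontr)
  assume neg: "\<not> det M > 0"
  define P where "P s = (1 - s) *\<^sub>R mat 1 + s *\<^sub>R M" for s :: real
  have cont: "continuous_on {0..1} (\<lambda>s. det (P s))"
    unfolding P_def by (intro continuous_on_det) (auto intro!: continuous_intros)
  have "P 0 = mat 1" "P 1 = M"
    by (simp_all add: P_def)
  with neg have "\<exists>s\<ge>0. s \<le> 1 \<and> det (P s) = 0"
    by (intro IVT2'[OF _ _ _ cont]) (auto simp: det_I)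
  then obtain s where s: "0 \<le> s" "s \<le> 1" "det (P s) = 0"
    by auto
  have "v \<bullet> (P s *v v) > 0" if "v \<noteq> 0" for v
  proof -
    have "v \<bullet> (P s *v v) = (1 - s) * (v \<bullet> v) + s * (v \<bullet> (M *v v))"
      by (simp add: P_def matrix_vector_mult_add_rdistrib scaleR_matrix_vector_assoc[symmetric] inner_add_right)
    moreover have "v \<bullet> v > 0" "v \<bullet> (M *v v) > 0"
      using pd that by auto
    ultimately show ?thesis
      using s(1,2) by (cases "s = 0") (simp_all add: add_nonneg_pos)
  qed
  then have "invertible (P s)"
    by (rule positive_definite_invertible)
  with s(3) show False
    by (simp add: invertible_det_nz)
qed

lemma positive_definite_inverse:
  fixes M :: "real ^ 'n::finite ^ 'n"
  assumes pd: "\<And>v. v \<noteq> 0 \<Longrightarrow> v \<bullet> (M *v v) > 0" and v: "v \<noteq> 0"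
  shows "v \<bullet> (matrix_inv M *v v) > 0"
proof -
  have "M *v (matrix_inv M *v v) = v"
    by (simp add: matrix_vector_mul_assoc matrix_inv_right_left positive_definite_invertible[OF pd])
  then show ?thesis
    using pd[of "matrix_inv M *v v"] v by (metis inner_commute matrix_vector_mult_0_right)
qed

text \<open>
  Cramer's rule: the entries of the inverse are quotients of polynomials in the entries of \<open>M\<close>, so they inherit
  differentiability (\<open>C1_on_matrix_inv\<close>).
\<close>

lemma matrix_inv_entry:
  fixes M :: "real ^ 'n::finite ^ 'n"
  assumes "det M \<noteq> 0"
  shows "matrix_inv M $ i $ j = det (\<chi> a b. if b = i then axis j 1 $ a else M $ a $ b) / det M"
proof -
  have "M *v (matrix_inv M *v axis j 1) = axis j 1"
    using assms by (simp add: matrix_vector_mul_assoc matrix_inv_right_left invertible_det_nz)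
  then have "matrix_inv M *v axis j 1 = (\<chi> k. det (\<chi> a b. if b = k then axis j 1 $ a else M $ a $ b) / det M)"
    by (simp add: cramer[OF assms])
  moreover have "(matrix_inv M *v axis j 1) $ i = matrix_inv M $ i $ j"
    by (simp add: matrix_vector_mul_component inner_axis)
  ultimately show ?thesis
    by simp
qed

lemma C1_on_det:
  fixes M :: "real ^ 'p::finite \<Rightarrow> real ^ 'n::finite ^ 'n"
  assumes "\<And>i j. C1_on S (\<lambda>x. M x $ i $ j)"
  shows "C1_on S (\<lambda>x. det (M x))"
  unfolding det_def by (intro C1_on_sum C1_on_mult C1_on_const C1_on_prod assms)

lemma C1_on_matrix_inv:
  fixes M :: "real ^ 'p::finite \<Rightarrow> real ^ 'n::finite ^ 'n"
  assumes "open S" and M: "\<And>i j. C1_on S (\<lambda>x. M x $ i $ j)" and nz: "\<And>x. x \<in> S \<Longrightarrow> det (M x) \<noteq> 0"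
  shows "C1_on S (\<lambda>x. matrix_inv (M x) $ i $ j)"
proof (rule C1_on_cong[OF assms(1)])
  have "C1_on S (\<lambda>x. if b = i then axis j 1 $ a else M x $ a $ b)" for a b
    using M C1_on_const by (cases "b = i") simp_all
  then show "C1_on S (\<lambda>x. det (\<chi> a b. if b = i then axis j 1 $ a else M x $ a $ b) / det (M x))"
    by (intro C1_on_divide C1_on_det M nz) auto
qed (simp add: matrix_inv_entry nz)


section \<open>The integral of a derivative with compact support\<close>

lemma DERIV_along_axis:
  assumes "C1_on UNIV h"
  shows "DERIV (\<lambda>s. h (x + s *\<^sub>R axis i 1)) s :> partial i h (x + s *\<^sub>R axis i 1)"
proof -
  have g: "(h has_derivative (\<lambda>v. v \<bullet> nabla h (x + s *\<^sub>R axis i 1))) (at (x + s *\<^sub>R axis i 1))"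
    using C1_on_GDERIV[OF assms] by (simp add: gderiv_def)
  have "((\<lambda>s. h (x + s *\<^sub>R axis i 1)) has_derivative
      (\<lambda>r. (r *\<^sub>R axis i 1) \<bullet> nabla h (x + s *\<^sub>R axis i 1))) (at s)"
    by (rule has_derivative_compose[where f = "\<lambda>s. x + s *\<^sub>R axis i 1", OF _ g])
       (auto intro!: derivative_eq_intros)
  moreover have "(\<lambda>r. (r *\<^sub>R axis i 1) \<bullet> nabla h (x + s *\<^sub>R axis i 1)) = (*) (partial i h (x + s *\<^sub>R axis i 1))"
    by (auto simp: inner_axis' fun_eq_iff nabla_def)
  ultimately show ?thesis
    by (simp add: has_field_derivative_def)
qed

lemma integrable_compact_support:
  fixes f :: "real ^ 'p::finite \<Rightarrow> real"
  assumes "continuous_on UNIV f" "compact K" "\<And>x. x \<notin> K \<Longrightarrow> f x = 0"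
  shows "integrable lborel f"
proof -
  have "integrable lborel (\<lambda>x. indicator K x *\<^sub>R f x)"
    using assms(1,2) by (intro borel_integrable_compact) (auto intro: continuous_on_subset)
  moreover have "(\<lambda>x. indicator K x *\<^sub>R f x) = f"
    using assms(3) by (auto simp: fun_eq_iff indicator_def)
  ultimately show ?thesis by simp
qed

text \<open>
  The difference quotients of \<open>h\<close> in direction \<open>i\<close> have integral zero by translation invariance, are bounded by
  the mean value theorem and supported in a common ball, and converge to the partial derivative.
\<close>

proposition integral_partial_compact_support:
  fixes h :: "real ^ 'p::finite \<Rightarrow> real"
  assumes h: "C1_on UNIV h" and K: "compact K" and 0: "\<And>x. x \<notin> K \<Longrightarrow> h x = 0"
  shows "integrable lborel (partial i h)" "integral\<^sup>L lborel (partial i h) = 0"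
proof -
  define e :: "real ^ 'p" where "e = axis i 1"
  have norm_e: "norm e = 1"
    by (simp add: e_def)
  have cont: "continuous_on UNIV h" "continuous_on UNIV (partial i h)"
    using h by (auto intro: C1_on_continuous C1_on_continuous_partial)
  have p0: "partial i h x = 0" if "x \<notin> K" for x
    using partial_cong_open[of "- K" x h "\<lambda>_. 0" i] that 0 compact_imp_closed[OF K]
    by (simp add: open_Compl GDERIV_imp_partial[OF GDERIV_const])
  show int: "integrable lborel (partial i h)"
    by (rule integrable_compact_support[OF cont(2) K p0])
  have inth: "integrable lborel h"
    by (rule integrable_compact_support[OF cont(1) K 0])
  have "bounded (partial i h ` K)"
    using cont(2) K by (intro compact_imp_bounded compact_continuous_image) (auto intro: continuous_on_subset)
  then obtain B where B: "\<And>x. x \<in> K \<Longrightarrow> \<bar>partial i h x\<bar> \<le> B" "0 < B"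
    by (auto simp: bounded_pos)
  have B': "\<bar>partial i h x\<bar> \<le> B" for x
    using B p0 by (cases "x \<in> K") auto
  obtain R where R: "\<And>x. x \<in> K \<Longrightarrow> norm x \<le> R"
    using compact_imp_bounded[OF K] by (auto simp: bounded_iff)
  define r where "r n = inverse (real (Suc n))" for n
  have r: "0 < r n" "r n \<le> 1" for n
    by (auto simp: r_def inverse_le_1_iff)
  \<comment> \<open>steps of length at most 1 keep the supports of all difference quotients in the ball of radius \<open>R + 1\<close>\<close>
  define s where "s n x = (h (x + r n *\<^sub>R e) - h x) / r n" for n x
  have lim: "(\<lambda>n. s n x) \<longlonglongrightarrow> partial i h x" for x
  proof -
    have "(\<lambda>t. (h (x + t *\<^sub>R e) - h x) / t) \<midarrow>0\<rightarrow> partial i h x"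
      using DERIV_along_axis[OF h, of x i 0] by (simp add: DERIV_def e_def)
    moreover have "filterlim r (at 0) sequentially"
    proof -
      have "r \<longlonglongrightarrow> 0"
        using LIMSEQ_inverse_real_of_nat unfolding r_def[abs_def] .
      then show ?thesis
        using r(1) by (auto simp: filterlim_at less_imp_neq[symmetric])
    qed
    ultimately show ?thesis
      unfolding s_def by (rule filterlim_compose)
  qed
  have bound: "\<bar>s n x\<bar> \<le> indicator (cball 0 (R + 1)) x * B" for n x
  proof (cases "x \<in> cball 0 (R + 1)")
    case True
    have "\<exists>z. 0 < z \<and> z < r n \<and> h (x + r n *\<^sub>R e) - h (x + 0 *\<^sub>R e) = (r n - 0) * partial i h (x + z *\<^sub>R e)"
      using r(1) DERIV_along_axis[OF h] unfolding e_def by (intro MVT2) auto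
    then obtain z where "h (x + r n *\<^sub>R e) - h x = r n * partial i h (x + z *\<^sub>R e)"
      by auto
    then have "s n x = partial i h (x + z *\<^sub>R e)"
      using r(1)[of n] by (simp add: s_def)
    then show ?thesis using True B' by simp
  next
    case False
    then have nx: "R + 1 < norm x" by simp
    moreover have "norm x \<le> norm (x + r n *\<^sub>R e) + norm (r n *\<^sub>R e)"
      by (metis add_diff_cancel_right' norm_triangle_ineq4)
    moreover have "norm (r n *\<^sub>R e) \<le> 1"
      using r(1)[of n] r(2)[of n] norm_e by simp
    ultimately have "x \<notin> K" "x + r n *\<^sub>R e \<notin> K"
      using R[of x] R[of "x + r n *\<^sub>R e"] by linarith+
    then show ?thesis using False 0 by (simp add: s_def)
  qed
  have meas: "h \<in> borel_measurable borel" "partial i h \<in> borel_measurable borel"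
    using cont by (auto intro: borel_measurable_continuous_onI)
  have ints: "integral\<^sup>L lborel (s n) = 0" for n
  proof -
    have shift: "integrable lborel (\<lambda>x. h (x + r n *\<^sub>R e))"
        "integral\<^sup>L lborel (\<lambda>x. h (x + r n *\<^sub>R e)) = integral\<^sup>L lborel h"
    proof -
      have d: "lborel = distr lborel borel ((+) (r n *\<^sub>R e))"
        by (rule lborel_distr_plus[symmetric])
      show "integrable lborel (\<lambda>x. h (x + r n *\<^sub>R e))"
        using inth meas(1) by (subst (asm) d, subst (asm) integrable_distr_eq) (auto simp: add.commute)
      show "integral\<^sup>L lborel (\<lambda>x. h (x + r n *\<^sub>R e)) = integral\<^sup>L lborel h"
        using meas(1) by (subst (2) d, subst integral_distr) (auto simp: add.commute)
    qed
    show ?thesis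
      unfolding s_def using shift inth by simp
  qed
  have "(\<lambda>n. integral\<^sup>L lborel (s n)) \<longlonglongrightarrow> integral\<^sup>L lborel (partial i h)"
  proof (rule integral_dominated_convergence)
    show "s n \<in> borel_measurable lborel" for n
      unfolding s_def using meas(1) by measurable
    show "integrable lborel (\<lambda>x :: real ^ 'p. indicator (cball 0 (R + 1)) x * B :: real)"
      using borel_integrable_compact[of "cball 0 (R + 1) :: (real ^ 'p) set" "\<lambda>_. B"] by simp
  qed (use meas lim bound in auto)
  then show "integral\<^sup>L lborel (partial i h) = 0"
    by (simp add: ints LIMSEQ_const_iff)
qed


section \<open>Functions on a manifold\<close>

definition C1_manifold :: "('a, 'p::finite) chart set \<Rightarrow> ('a \<Rightarrow> real) \<Rightarrow> bool" where
  "C1_manifold A u \<longleftrightarrow> (\<forall>c\<in>A. C1_on (chart_codom c) (u \<circ> param c))"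

lemma C1_manifoldD: "C1_manifold A u \<Longrightarrow> c \<in> A \<Longrightarrow> C1_on (chart_codom c) (u \<circ> param c)"
  by (simp add: C1_manifold_def)

lemma C1_manifold_const: "C1_manifold A (\<lambda>x. k)"
  by (auto simp: C1_manifold_def comp_def)

lemma C1_manifold_mult: "C1_manifold A u \<Longrightarrow> C1_manifold A v \<Longrightarrow> C1_manifold A (\<lambda>x. u x * v x)"
  by (auto simp: C1_manifold_def comp_def intro: C1_on_mult)

lemma C1_manifold_sum:
  "(\<And>i. i \<in> I \<Longrightarrow> C1_manifold A (u i)) \<Longrightarrow> C1_manifold A (\<lambda>x. \<Sum>i\<in>I. u i x)"
  by (auto simp: C1_manifold_def comp_def intro: C1_on_sum)

lemma C1_manifold_exp: "C1_manifold A u \<Longrightarrow> C1_manifold A (\<lambda>x. exp (u x))"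
  by (auto simp: C1_manifold_def comp_def intro: C1_on_exp)

text \<open>
  Squaring removes the kink of the positive part. First derivatives of test functions are all that
  integration by parts uses, so this elementary bump can replace the smooth exponential one.
\<close>

lemma C1_on_pos_part_squared:
  assumes "C1_on S f"
  shows "C1_on S (\<lambda>x. (max 0 (f x))\<^sup>2)"
proof (rule C1_on_DERIV_compose[OF assms, where h = "\<lambda>t. (max 0 t)\<^sup>2" and h' = "\<lambda>t. 2 * max 0 t"])
  fix x
  show "((\<lambda>t::real. (max 0 t)\<^sup>2) has_real_derivative 2 * max 0 (f x)) (at (f x))"
  proof (cases "f x" "0::real" rule: linorder_cases)
    case less
    have "((\<lambda>t::real. 0) has_real_derivative 2 * max 0 (f x)) (at (f x))"
      using less by auto
    then show ?thesis
      by (rule has_field_derivative_transform_within_open[where S = "{..<0}"]) (use less in \<open>auto simp: max_def\<close>)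
  next
    case greater
    have "((\<lambda>t::real. t\<^sup>2) has_real_derivative 2 * max 0 (f x)) (at (f x))"
      using greater by (auto intro!: derivative_eq_intros)
    then show ?thesis
      by (rule has_field_derivative_transform_within_open[where S = "{0<..}"]) (use greater in \<open>auto simp: max_def\<close>)
  next
    case equal
    have "((\<lambda>t::real. max 0 t) \<longlongrightarrow> max 0 0) (at 0)"
      by (intro tendsto_intros)
    moreover have "(max 0 t)\<^sup>2 / t = max 0 t" for t :: real
      by (auto simp: max_def power2_eq_square)
    ultimately show ?thesis
      by (simp add: equal DERIV_def)
  qed
next
  show "continuous_on (f ` S) (\<lambda>t. 2 * max 0 t)"
    by (intro continuous_intros)
qed

lemma bump_function_euclidean:
  fixes z :: "real ^ 'p::finite"
  assumes "r > 0"
  obtains \<beta> where "C1_on UNIV \<beta>" "\<And>y. \<beta> y \<ge> 0" "\<beta> z > 0" "\<And>y. y \<notin> cball z r \<Longrightarrow> \<beta> y = 0"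
proof
  define \<beta> where "\<beta> y = (max 0 (r\<^sup>2 - (y - z) \<bullet> (y - z)))\<^sup>2" for y
  have "C1_on UNIV (\<lambda>y. r\<^sup>2 - (y - z) \<bullet> (y - z))"
    by (rule C1_onI[of _ "\<lambda>y. - 2 *\<^sub>R (y - z)"])
       (auto intro!: continuous_intros derivative_eq_intros
             simp: gderiv_def inner_commute inner_diff_left inner_diff_right)
  then show "C1_on UNIV \<beta>"
    unfolding \<beta>_def by (rule C1_on_pos_part_squared)
  show "\<beta> y \<ge> 0" for y
    by (simp add: \<beta>_def)
  show "\<beta> z > 0"
    using assms by (simp add: \<beta>_def)
  show "\<beta> y = 0" if "y \<notin> cball z r" for y
  proof -
    have "r\<^sup>2 \<le> (norm (y - z))\<^sup>2"
      using that assms by (intro power_mono) (auto simp: dist_norm norm_minus_commute)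
    then show ?thesis
      by (simp add: \<beta>_def dot_square_norm)
  qed
qed

context smooth_manifold
begin

lemma
  assumes c: "c \<in> A"
  shows coord_in: "x \<in> chart_dom c \<Longrightarrow> coord c x \<in> chart_codom c"
    and dom_subset: "chart_dom c \<subseteq> topspace X"
    and param_coord: "x \<in> chart_dom c \<Longrightarrow> param c (coord c x) = x"
    and param_in: "y \<in> chart_codom c \<Longrightarrow> param c y \<in> chart_dom c"
    and coord_param: "y \<in> chart_codom c \<Longrightarrow> coord c (param c y) = y"
proof -
  show dom: "chart_dom c \<subseteq> topspace X"
    using cover c by auto
  have "inj_on (coord c) (chart_dom c)"
    using homeomorphic[OF c] dom by (auto simp: homeomorphic_map_def Int_absorb1)
  then show "x \<in> chart_dom c \<Longrightarrow> param c (coord c x) = x"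
    unfolding param_def by (rule inv_into_f_f)
  show "x \<in> chart_dom c \<Longrightarrow> coord c x \<in> chart_codom c"
    unfolding chart_codom_def by (rule imageI)
  show "y \<in> chart_codom c \<Longrightarrow> param c y \<in> chart_dom c"
    unfolding chart_codom_def param_def by (rule inv_into_into)
  show "y \<in> chart_codom c \<Longrightarrow> coord c (param c y) = y"
    unfolding chart_codom_def param_def by (rule f_inv_into_f)
qed

lemma chart_around:
  assumes "x \<in> topspace X" obtains c where "c \<in> A" "x \<in> chart_dom c"
  using assms cover by blast

lemma coord_image:
  assumes "c \<in> A" "U \<subseteq> chart_dom c"
  shows "coord c ` U = {y \<in> chart_codom c. param c y \<in> U}"
proof (intro set_eqI iffI)
  fix y assume "y \<in> {y \<in> chart_codom c. param c y \<in> U}"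
  then show "y \<in> coord c ` U"
    using coord_param[OF assms(1), of y] by (auto intro!: image_eqI[of y _ "param c y"])
qed (use assms(2) coord_in[OF assms(1)] param_coord[OF assms(1)] in auto)

lemma param_image:
  assumes "c \<in> A" "V \<subseteq> chart_codom c"
  shows "param c ` V = {x \<in> chart_dom c. coord c x \<in> V}"
proof (intro set_eqI iffI)
  fix x assume "x \<in> {x \<in> chart_dom c. coord c x \<in> V}"
  then show "x \<in> param c ` V"
    using param_coord[OF assms(1), of x] by (auto intro!: image_eqI[of x _ "coord c x"])
qed (use assms(2) param_in[OF assms(1)] coord_param[OF assms(1)] in auto)

lemma coord_param_image:
  assumes "c \<in> A" "V \<subseteq> chart_codom c"
  shows "coord c ` param c ` V = V"
  using coord_param[OF assms(1)] assms(2) by (simp add: image_image subset_iff cong: image_cong)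

lemma open_coord_image:
  assumes c: "c \<in> A" and "openin X U" "U \<subseteq> chart_dom c"
  shows "open (coord c ` U)"
proof -
  have "openin (subtopology X (chart_dom c)) U"
    using assms open_dom[OF c] by (simp add: openin_open_subtopology)
  then have "openin (top_of_set (chart_codom c)) (coord c ` U)"
    using homeomorphic_map_openness_eq[OF homeomorphic[OF c]] by blast
  then show ?thesis
    using open_codom[OF c] by (simp add: openin_open_eq)
qed

lemma open_param_image:
  assumes c: "c \<in> A" and V: "open V" "V \<subseteq> chart_codom c"
  shows "openin X (param c ` V)"
proof -
  have "openin (top_of_set (chart_codom c)) (coord c ` param c ` V)"
    using open_codom[OF c] V by (simp add: coord_param_image[OF c] openin_open_eq)
  moreover have "param c ` V \<subseteq> topspace (subtopology X (chart_dom c))"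
    using V(2) param_in[OF c] dom_subset[OF c] by auto
  ultimately have "openin (subtopology X (chart_dom c)) (param c ` V)"
    using homeomorphic_map_openness[OF homeomorphic[OF c]] by blast
  then show ?thesis
    using open_dom[OF c] by (simp add: openin_open_subtopology)
qed

lemma compact_param_image:
  assumes c: "c \<in> A" and L: "compact L" "L \<subseteq> chart_codom c"
  shows "compactin X (param c ` L)"
proof -
  have "continuous_map (top_of_set (chart_codom c)) X (param c)"
    unfolding continuous_map_openin_preimage_eq
  proof (intro conjI allI impI)
    show "param c \<in> topspace (top_of_set (chart_codom c)) \<rightarrow> topspace X"
      using param_in[OF c] dom_subset[OF c] by auto
    fix U assume U: "openin X U"
    have "topspace (top_of_set (chart_codom c)) \<inter> param c -` U = coord c ` (chart_dom c \<inter> U)"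
      by (subst coord_image[OF c]) (auto simp: param_in[OF c])
    moreover have "open (coord c ` (chart_dom c \<inter> U))"
      using U open_dom[OF c] c by (intro open_coord_image) auto
    ultimately show "openin (top_of_set (chart_codom c)) (topspace (top_of_set (chart_codom c)) \<inter> param c -` U)"
      using open_codom[OF c] by (auto simp: openin_open_eq)
  qed
  moreover have "compactin (top_of_set (chart_codom c)) L"
    using L by (simp add: compactin_subtopology)
  ultimately show ?thesis
    using image_compactin by blast
qed

lemma compact_coord_image:
  assumes c: "c \<in> A" and K: "compactin X K" "K \<subseteq> chart_dom c"
  shows "compact (coord c ` K)"
proof -
  have "compactin (top_of_set (chart_codom c)) (coord c ` K)"
    using K homeomorphic[OF c]
    by (intro image_compactin[of "subtopology X (chart_dom c)"])
       (auto simp: compactin_subtopology homeomorphic_eq_everything_map)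
  then show ?thesis
    by (simp add: compactin_subtopology)
qed

lemma openin_diff_compact: "openin X U \<Longrightarrow> compactin X K \<Longrightarrow> openin X (U - K)"
  using compactin_imp_closedin[OF Hausdorff] by (intro openin_diff)

lemma continuous_map_charts:
  assumes "\<And>c. c \<in> A \<Longrightarrow> continuous_on (chart_codom c) (f \<circ> param c)"
  shows "continuous_map X euclideanreal f"
  unfolding continuous_map_openin_preimage_eq
proof (intro conjI allI impI)
  fix U :: "real set" assume U: "openin euclidean U"
  have "openin X (param c ` (chart_codom c \<inter> (f \<circ> param c) -` U))" if c: "c \<in> A" for c
    using U open_codom[OF c] assms[OF c]
    by (intro open_param_image c) (auto simp: continuous_on_open_vimage Int_commute comp_def)
  then have "openin X (\<Union>c\<in>A. param c ` (chart_codom c \<inter> (f \<circ> param c) -` U))"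
    by blast
  moreover have "(\<Union>c\<in>A. param c ` (chart_codom c \<inter> (f \<circ> param c) -` U)) = topspace X \<inter> f -` U"
  proof -
    have "param c ` (chart_codom c \<inter> (f \<circ> param c) -` U) = chart_dom c \<inter> f -` U" if "c \<in> A" for c
      by (subst param_image[OF that]) (auto simp: param_coord[OF that] coord_in[OF that])
    then show ?thesis
      using cover by auto
  qed
  ultimately show "openin X (topspace X \<inter> f -` U)"
    by simp
qed auto

lemma C1_manifold_continuous: "C1_manifold A u \<Longrightarrow> continuous_map X euclideanreal u"
  by (rule continuous_map_charts) (rule C1_on_continuous[OF C1_manifoldD])

lemma C1_manifold_divide:
  assumes u: "C1_manifold A u" and v: "C1_manifold A v" and nz: "\<And>x. x \<in> topspace X \<Longrightarrow> v x \<noteq> 0"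
  shows "C1_manifold A (\<lambda>x. u x / v x)"
  unfolding C1_manifold_def comp_def
proof
  fix c assume c: "c \<in> A"
  show "C1_on (chart_codom c) (\<lambda>y. u (param c y) / v (param c y))"
    using C1_manifoldD[OF u c] C1_manifoldD[OF v c] param_in[OF c] dom_subset[OF c] nz
    by (intro C1_on_divide) (auto simp: comp_def)
qed

lemma overlap_altdef:
  "c \<in> A \<Longrightarrow> overlap c c' = {y \<in> chart_codom c. param c y \<in> chart_dom c'}"
  unfolding overlap_def using param_in[of c] by (subst coord_image) auto

lemma open_overlap: "c \<in> A \<Longrightarrow> c' \<in> A \<Longrightarrow> open (overlap c c')"
  unfolding overlap_def by (intro open_coord_image openin_Int open_dom) auto

lemma transition_C1:
  "c \<in> A \<Longrightarrow> c' \<in> A \<Longrightarrow> C1_on (overlap c c') (\<lambda>y. transition c c' y $ i)"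
  by (rule smooth_on_imp_C1_on[OF compatible open_overlap])

lemma param_transition:
  "c \<in> A \<Longrightarrow> c' \<in> A \<Longrightarrow> y \<in> overlap c c' \<Longrightarrow> param c' (transition c c' y) = param c y"
  by (simp add: transition_def overlap_altdef param_coord)

lemma transition_in_codom:
  "c \<in> A \<Longrightarrow> c' \<in> A \<Longrightarrow> y \<in> overlap c c' \<Longrightarrow> transition c c' y \<in> chart_codom c'"
  by (simp add: transition_def overlap_altdef coord_in)

text \<open>
  A compact set is closed in the Hausdorff space \<open>X\<close>, so its complement is open; every other chart is
  covered by the overlap, where the chain rule through the transition map applies, and by this
  complement, where the function vanishes.
\<close>

lemma C1_manifold_extend_by_zero:
  assumes c: "c \<in> A" and \<beta>: "C1_on (chart_codom c) \<beta>"
    and L: "compact L" "L \<subseteq> chart_codom c" "\<And>y. y \<notin> L \<Longrightarrow> \<beta> y = 0"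
  shows "C1_manifold A (\<lambda>x. if x \<in> chart_dom c then \<beta> (coord c x) else 0)" (is "C1_manifold A ?b")
  unfolding C1_manifold_def
proof
  fix c' assume c': "c' \<in> A"
  define V where "V = coord c' ` (chart_dom c' - param c ` L)"
  have openV: "open V"
    unfolding V_def
    by (intro open_coord_image c' openin_diff_compact open_dom compact_param_image c L) auto
  have "C1_on (overlap c' c) (\<lambda>y. \<beta> (transition c' c y))"
    using transition_in_codom[OF c' c] by (intro C1_on_compose[OF transition_C1 \<beta>] c c') auto
  then have 1: "C1_on (overlap c' c) (?b \<circ> param c')"
    by (rule C1_on_cong[OF open_overlap[OF c' c], rotated])
       (use c c' in \<open>auto simp: overlap_altdef transition_def\<close>)
  have "?b (param c' y) = 0" if "y \<in> V" for y
  proof -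
    have "param c' y \<notin> param c ` L"
      using that by (auto simp: V_def param_coord[OF c'])
    then show ?thesis
      using L(2) param_coord[OF c, of "param c' y"] by (metis L(3) image_eqI)
  qed
  then have 2: "C1_on V (?b \<circ> param c')"
    by (intro C1_on_cong[OF openV _ C1_on_const[of V 0]]) simp
  have "C1_on (overlap c' c \<union> V) (?b \<circ> param c')"
    by (intro C1_on_Un 1 2 open_overlap c c' openV)
  moreover have "chart_codom c' \<subseteq> overlap c' c \<union> V"
  proof
    fix y assume y: "y \<in> chart_codom c'"
    have "param c ` L \<subseteq> chart_dom c"
      using L(2) param_in[OF c] by blast
    then show "y \<in> overlap c' c \<union> V"
      using y param_in[OF c' y]
      by (cases "param c' y \<in> chart_dom c")
         (auto simp: overlap_altdef c' V_def coord_image)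
  qed
  ultimately show "C1_on (chart_codom c') (?b \<circ> param c')"
    by (rule C1_on_subset)
qed

lemma bump_function:
  assumes U: "openin X U" "x \<in> U"
  obtains b K where "C1_manifold A b" "\<And>y. b y \<ge> 0" "b x > 0"
    "compactin X K" "K \<subseteq> U" "\<And>y. y \<notin> K \<Longrightarrow> b y = 0"
proof -
  have "x \<in> topspace X"
    using U openin_subset by blast
  then obtain c where c: "c \<in> A" "x \<in> chart_dom c"
    by (rule chart_around)
  define V where "V = coord c ` (U \<inter> chart_dom c)"
  have V: "open V" "coord c x \<in> V" "V \<subseteq> chart_codom c"
    using U c open_dom[OF c(1)] coord_in[OF c(1)] by (auto simp: V_def intro!: open_coord_image)
  then obtain r where r: "r > 0" "cball (coord c x) r \<subseteq> V"
    using open_contains_cball by blast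
  obtain \<beta> where \<beta>: "C1_on UNIV \<beta>" "\<And>y. \<beta> y \<ge> 0" "\<beta> (coord c x) > 0"
    "\<And>y. y \<notin> cball (coord c x) r \<Longrightarrow> \<beta> y = 0"
    using bump_function_euclidean[OF r(1)] by metis
  let ?L = "cball (coord c x) r"
  let ?b = "\<lambda>y. if y \<in> chart_dom c then \<beta> (coord c y) else 0"
  have L: "compact ?L" "?L \<subseteq> chart_codom c"
    using r V by auto
  show thesis
  proof (rule that[of ?b "param c ` ?L"])
    show "C1_manifold A ?b"
      using \<beta>(1,4) by (intro C1_manifold_extend_by_zero[OF c(1) _ L]) (auto intro: C1_on_subset)
    show "compactin X (param c ` ?L)"
      by (rule compact_param_image[OF c(1) L])
    have "param c ` ?L \<subseteq> param c ` V"
      using r(2) by (rule image_mono)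
    also have "param c ` V \<subseteq> U"
      using param_coord[OF c(1)] by (auto simp: V_def)
    finally show "param c ` ?L \<subseteq> U" .
    show "?b y = 0" if "y \<notin> param c ` ?L" for y
      using that \<beta>(4) param_coord[OF c(1)] by (metis image_eqI)
  qed (use \<beta> c in auto)
qed

text \<open>
  Bumps whose positivity sets cover \<open>X\<close>, finitely many by compactness, divided by their sum.
\<close>

lemma partition_of_unity:
  assumes "compact_space X"
  obtains I :: "'a set" and \<phi> K \<kappa> where "finite I"
    "\<And>i. i \<in> I \<Longrightarrow> C1_manifold A (\<phi> i)" "\<And>i. i \<in> I \<Longrightarrow> \<kappa> i \<in> A"
    "\<And>i. i \<in> I \<Longrightarrow> compactin X (K i)" "\<And>i. i \<in> I \<Longrightarrow> K i \<subseteq> chart_dom (\<kappa> i)"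
    "\<And>i y. i \<in> I \<Longrightarrow> y \<notin> K i \<Longrightarrow> \<phi> i y = 0"
    "\<And>y. y \<in> topspace X \<Longrightarrow> (\<Sum>i\<in>I. \<phi> i y) = 1"
proof -
  have "\<exists>c b K. c \<in> A \<and> C1_manifold A b \<and> (\<forall>y. b y \<ge> 0) \<and> b x > 0 \<and>
      compactin X K \<and> K \<subseteq> chart_dom c \<and> (\<forall>y. y \<notin> K \<longrightarrow> b y = 0)" if "x \<in> topspace X" for x
  proof -
    from that obtain c where c: "c \<in> A" "x \<in> chart_dom c"
      by (rule chart_around)
    obtain b K where "C1_manifold A b" "\<And>y. b y \<ge> 0" "b x > 0"
        "compactin X K" "K \<subseteq> chart_dom c" "\<And>y. y \<notin> K \<Longrightarrow> b y = 0"
      using bump_function[OF open_dom[OF c(1)] c(2)] by metis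
    with c(1) show ?thesis by blast
  qed
  then obtain \<kappa> b K where *: "\<And>x. x \<in> topspace X \<Longrightarrow> \<kappa> x \<in> A \<and> C1_manifold A (b x) \<and>
      (\<forall>y. b x y \<ge> (0::real)) \<and> b x x > 0 \<and> compactin X (K x) \<and> K x \<subseteq> chart_dom (\<kappa> x) \<and>
      (\<forall>y. y \<notin> K x \<longrightarrow> b x y = 0)"
    by metis
  define V where "V x = {y \<in> topspace X. b x y \<in> {0<..}}" for x
  have "openin X (V x)" if "x \<in> topspace X" for x
    using *[OF that] C1_manifold_continuous unfolding V_def
    by (intro openin_continuous_map_preimage[of X euclideanreal]) auto
  moreover have "topspace X \<subseteq> \<Union> (V ` topspace X)"
    using * by (auto simp: V_def)
  ultimately have "\<exists>\<F>. finite \<F> \<and> \<F> \<subseteq> V ` topspace X \<and> topspace X \<subseteq> \<Union>\<F>"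
    using assms[unfolded compact_space_alt, rule_format, of "V ` topspace X"] by simp
  then obtain \<F> where \<F>: "finite \<F>" "\<F> \<subseteq> V ` topspace X" "topspace X \<subseteq> \<Union>\<F>"
    by blast
  obtain I where I: "finite I" "I \<subseteq> topspace X" "topspace X \<subseteq> \<Union> (V ` I)"
    using finite_subset_image[OF \<F>(1,2)] \<F>(3) by metis
  define S where "S y = (\<Sum>x\<in>I. b x y)" for y
  have S: "S y > 0" if y: "y \<in> topspace X" for y
  proof -
    obtain x where x: "x \<in> I" "b x y > 0"
      using I(3) y by (auto simp: V_def)
    show ?thesis
      unfolding S_def using I(1,2) * x by (intro sum_pos2[of I x]) auto
  qed
  have "C1_manifold A S"
    unfolding S_def using I(2) * by (intro C1_manifold_sum) auto
  show thesis
  proof (rule that[of I "\<lambda>x y. b x y / S y" \<kappa> K])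
    show "C1_manifold A (\<lambda>y. b i y / S y)" if "i \<in> I" for i
      using that I(2) * S \<open>C1_manifold A S\<close> by (intro C1_manifold_divide) (auto simp: less_imp_neq[symmetric] dest: S)
    show "(\<Sum>i\<in>I. b i y / S y) = 1" if "y \<in> topspace X" for y
      using S[OF that] by (simp add: sum_divide_distrib[symmetric] S_def[symmetric])
  qed (use I * in auto)
qed

end


section \<open>The uniform measure\<close>

context oriented_riemannian_manifold
begin

lemma metric_det_pos: "c \<in> A \<Longrightarrow> y \<in> chart_codom c \<Longrightarrow> det (G c y) > 0"
  using metric_positive by (intro positive_definite_det_pos)

lemma metric_invertible: "c \<in> A \<Longrightarrow> y \<in> chart_codom c \<Longrightarrow> invertible (G c y)"
  using metric_positive by (intro positive_definite_invertible)

lemma metric_C1: "c \<in> A \<Longrightarrow> C1_on (chart_codom c) (\<lambda>y. G c y $ i $ j)"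
  by (rule smooth_on_imp_C1_on[OF metric_smooth open_codom])

lemma volume_density_C1: "c \<in> A \<Longrightarrow> C1_on (chart_codom c) (\<lambda>y. sqrt (det (G c y)))"
  by (intro C1_on_sqrt C1_on_det metric_C1 metric_det_pos)

lemma inverse_metric_C1: "c \<in> A \<Longrightarrow> C1_on (chart_codom c) (\<lambda>y. matrix_inv (G c y) $ i $ j)"
  using metric_det_pos by (intro C1_on_matrix_inv open_codom metric_C1) (auto simp: less_imp_neq[symmetric])

end

locale riemannian_measure = compact_oriented_riemannian_manifold X A G
  for X :: "'a topology" and A :: "('a, 'p::finite) chart set"
    and G :: "('a, 'p) chart \<Rightarrow> real ^ 'p \<Rightarrow> real ^ 'p ^ 'p" +
  fixes \<mu> :: "'a measure"
  assumes uniform: "uniform_measure_on X A G \<mu>"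
begin

lemma space_eq: "space \<mu> = topspace X"
  and sets_eq: "sets \<mu> = sigma_sets (topspace X) {U. openin X U}"
  using uniform by (auto simp: uniform_measure_on_def)

lemma emeasure_chart:
  "c \<in> A \<Longrightarrow> B \<in> sets \<mu> \<Longrightarrow> B \<subseteq> chart_dom c \<Longrightarrow>
    emeasure \<mu> B = (\<integral>\<^sup>+y\<in>coord c ` B. ennreal (sqrt (det (G c y))) \<partial>lborel)"
  using uniform unfolding uniform_measure_on_def by blast

lemma open_sets: "openin X U \<Longrightarrow> U \<in> sets \<mu>"
  unfolding sets_eq by (rule sigma_sets.Basic) simp

lemma compact_sets:
  assumes "compactin X K" shows "K \<in> sets \<mu>"
proof -
  have "closedin X K"
    by (rule compactin_imp_closedin[OF Hausdorff assms])
  then have "topspace X - (topspace X - K) \<in> sets \<mu>"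
    using open_sets sets.compl_sets[of _ \<mu>] by (simp add: space_eq openin_diff)
  moreover have "topspace X - (topspace X - K) = K"
    using compactin_subset_topspace[OF assms] by auto
  ultimately show ?thesis by simp
qed

lemma continuous_measurable:
  assumes "continuous_map X euclideanreal f"
  shows "f \<in> borel_measurable \<mu>"
proof (rule borel_measurableI)
  fix S :: "real set" assume "open S"
  then have "openin X {x \<in> topspace X. f x \<in> S}"
    using openin_continuous_map_preimage[OF assms] by simp
  moreover have "f -` S \<inter> space \<mu> = {x \<in> topspace X. f x \<in> S}"
    by (auto simp: space_eq)
  ultimately show "f -` S \<inter> space \<mu> \<in> sets \<mu>"
    using open_sets by simp
qed

lemma param_measurable:
  assumes c: "c \<in> A"
  shows "param c \<in> restrict_space lborel (chart_codom c) \<rightarrow>\<^sub>M restrict_space \<mu> (chart_dom c)"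
proof (rule measurable_restrict_space2)
  show "param c \<in> space (restrict_space lborel (chart_codom c)) \<rightarrow> chart_dom c"
    using param_in[OF c] by (auto simp: space_restrict_space)
  show "param c \<in> measurable (restrict_space lborel (chart_codom c)) \<mu>"
  proof (rule measurable_sigma_sets[OF sets_eq])
    show "{U. openin X U} \<subseteq> Pow (topspace X)"
      using openin_subset by auto
    show "param c \<in> space (restrict_space lborel (chart_codom c)) \<rightarrow> topspace X"
      using param_in[OF c] dom_subset[OF c] by (auto simp: space_restrict_space)
    fix U assume "U \<in> {U. openin X U}"
    then have "open (coord c ` (chart_dom c \<inter> U))"
      using open_dom[OF c] by (intro open_coord_image[OF c]) auto
    moreover have "param c -` U \<inter> space (restrict_space lborel (chart_codom c)) = coord c ` (chart_dom c \<inter> U)"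
      by (subst coord_image[OF c]) (auto simp: param_in[OF c] space_restrict_space)
    moreover have "coord c ` (chart_dom c \<inter> U) \<subseteq> chart_codom c"
      using coord_in[OF c] by auto
    ultimately show "param c -` U \<inter> space (restrict_space lborel (chart_codom c))
        \<in> sets (restrict_space lborel (chart_codom c))"
      using open_codom[OF c] by (simp add: sets_restrict_space_iff)
  qed
qed

lemma volume_density_measurable:
  assumes c: "c \<in> A"
  shows "(\<lambda>y. sqrt (det (G c y))) \<in> borel_measurable (restrict_space lborel (chart_codom c))"
proof -
  have "(\<lambda>y. sqrt (det (G c y))) \<in> borel_measurable (restrict_space borel (chart_codom c))"
    by (intro borel_measurable_continuous_on_restrict C1_on_continuous volume_density_C1 c)
  then show ?thesis
    by (simp cong: measurable_cong_sets sets_restrict_space_cong)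
qed

text \<open>
  The defining property of \<open>\<mu>\<close> concerns single Borel sets; as an identity of measures it transfers
  integrals from the chart to Euclidean space.
\<close>

lemma restrict_measure_chart:
  assumes c: "c \<in> A"
  shows "restrict_space \<mu> (chart_dom c) =
    distr (density (restrict_space lborel (chart_codom c)) (\<lambda>y. ennreal (sqrt (det (G c y)))))
      (restrict_space \<mu> (chart_dom c)) (param c)"
    (is "?M = distr ?N ?M (param c)")
proof (rule measure_eqI)
  show "sets ?M = sets (distr ?N ?M (param c))"
    by simp
  fix B assume B: "B \<in> sets ?M"
  have dom: "chart_dom c \<in> sets \<mu>"
    by (rule open_sets[OF open_dom[OF c]])
  have B': "B \<in> sets \<mu>" "B \<subseteq> chart_dom c"
    using B dom by (auto simp: sets_restrict_space_iff)
  have par: "param c \<in> ?N \<rightarrow>\<^sub>M ?M"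
    using param_measurable[OF c] by (simp cong: measurable_cong_sets)
  have pre: "param c -` B \<inter> space ?N = coord c ` B"
    using B'(2) by (subst coord_image[OF c B'(2)]) (auto simp: space_restrict_space)
  have sB: "coord c ` B \<in> sets (restrict_space lborel (chart_codom c))"
    using measurable_sets[OF par B] unfolding pre by simp
  have "emeasure (distr ?N ?M (param c)) B = emeasure ?N (coord c ` B)"
    using emeasure_distr[OF par B] unfolding pre .
  also have "\<dots> = (\<integral>\<^sup>+y. ennreal (sqrt (det (G c y))) * indicator (coord c ` B) y
      \<partial>restrict_space lborel (chart_codom c))"
    using volume_density_measurable[OF c] sB by (intro emeasure_density) auto
  also have "\<dots> = (\<integral>\<^sup>+y. ennreal (sqrt (det (G c y))) * indicator (coord c ` B) y
      * indicator (chart_codom c) y \<partial>lborel)"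
    using open_codom[OF c] by (intro nn_integral_restrict_space) simp
  also have "\<dots> = (\<integral>\<^sup>+y. ennreal (sqrt (det (G c y))) * indicator (coord c ` B) y \<partial>lborel)"
    using B'(2) coord_in[OF c] by (intro nn_integral_cong) (auto simp: indicator_def)
  also have "\<dots> = emeasure \<mu> B"
    by (rule emeasure_chart[OF c B', symmetric])
  also have "\<dots> = emeasure ?M B"
    using dom B'(2) by (intro emeasure_restrict_space[symmetric]) (auto simp: sets.Int_space_eq2)
  finally show "emeasure ?M B = emeasure (distr ?N ?M (param c)) B" ..
qed

lemma integral_chart:
  fixes f :: "'a \<Rightarrow> real"
  assumes c: "c \<in> A" and f: "f \<in> borel_measurable \<mu>"
    and 0: "\<And>x. x \<in> topspace X \<Longrightarrow> x \<notin> chart_dom c \<Longrightarrow> f x = 0"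
  shows "integral\<^sup>L \<mu> f =
    (LINT y|lborel. indicator (chart_codom c) y * (sqrt (det (G c y)) * f (param c y)))"
proof -
  let ?M = "restrict_space \<mu> (chart_dom c)" and ?L = "restrict_space lborel (chart_codom c)"
  let ?N = "density ?L (\<lambda>y. ennreal (sqrt (det (G c y))))"
  have par: "param c \<in> ?N \<rightarrow>\<^sub>M ?M" "param c \<in> ?L \<rightarrow>\<^sub>M ?M"
    using param_measurable[OF c] by (simp_all cong: measurable_cong_sets)
  have fM: "f \<in> borel_measurable ?M"
    by (rule measurable_restrict_space1[OF f])
  have "integral\<^sup>L \<mu> f = integral\<^sup>L \<mu> (\<lambda>x. indicator (chart_dom c) x *\<^sub>R f x)"
    using 0 by (intro Bochner_Integration.integral_cong) (auto simp: indicator_def space_eq)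
  also have "\<dots> = integral\<^sup>L ?M f"
    using open_sets[OF open_dom[OF c]] by (intro integral_restrict_space[symmetric]) (simp add: sets.Int_space_eq2)
  also have "\<dots> = integral\<^sup>L (distr ?N ?M (param c)) f"
    using restrict_measure_chart[OF c] by simp
  also have "\<dots> = integral\<^sup>L ?N (\<lambda>y. f (param c y))"
    by (rule integral_distr[OF par(1) fM])
  also have "\<dots> = integral\<^sup>L ?L (\<lambda>y. sqrt (det (G c y)) *\<^sub>R f (param c y))"
    using volume_density_measurable[OF c] measurable_compose[OF par(2) fM] metric_det_pos[OF c]
    by (intro integral_density) (auto simp: space_restrict_space less_imp_le)
  also have "\<dots> = (LINT y|lborel. indicator (chart_codom c) y *\<^sub>R (sqrt (det (G c y)) *\<^sub>R f (param c y)))"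
    using open_codom[OF c] by (intro integral_restrict_space) simp
  finally show ?thesis by simp
qed

lemma emeasure_compact_chart:
  assumes c: "c \<in> A" and K: "compactin X K" "K \<subseteq> chart_dom c"
  shows "emeasure \<mu> K < \<infinity>"
proof -
  have L: "compact (coord c ` K)" "coord c ` K \<subseteq> chart_codom c"
    using compact_coord_image[OF c K] coord_in[OF c] K(2) by auto
  have "bounded ((\<lambda>y. sqrt (det (G c y))) ` coord c ` K)"
    using C1_on_continuous[OF volume_density_C1[OF c]] L
    by (intro compact_imp_bounded compact_continuous_image) (auto intro: continuous_on_subset)
  then obtain M where "\<And>y. y \<in> coord c ` K \<Longrightarrow> norm (sqrt (det (G c y))) \<le> M"
    unfolding bounded_iff by blast
  then have M: "sqrt (det (G c y)) \<le> M" if "y \<in> coord c ` K" for y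
    using that abs_le_D1 by (metis real_norm_def)
  have "emeasure \<mu> K = (\<integral>\<^sup>+y\<in>coord c ` K. ennreal (sqrt (det (G c y))) \<partial>lborel)"
    by (rule emeasure_chart[OF c compact_sets[OF K(1)] K(2)])
  also have "\<dots> \<le> (\<integral>\<^sup>+y. ennreal M * indicator (coord c ` K) y \<partial>lborel)"
    using M by (intro nn_integral_mono) (auto simp: indicator_def intro: ennreal_leI)
  also have "\<dots> = ennreal M * emeasure lborel (coord c ` K)"
    using L(1) by (intro nn_integral_cmult_indicator) (simp add: borel_compact)
  also have "\<dots> < \<infinity>"
    using emeasure_compact_finite[OF L(1)] by (simp add: ennreal_mult_less_top)
  finally show ?thesis .
qed

lemma finite_measure: "finite_measure \<mu>"
proof (rule finite_measureI)
  obtain I :: "'a set" and \<phi> K \<kappa> where P: "finite I"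
    "\<And>i. i \<in> I \<Longrightarrow> C1_manifold A (\<phi> i)" "\<And>i. i \<in> I \<Longrightarrow> \<kappa> i \<in> A"
    "\<And>i. i \<in> I \<Longrightarrow> compactin X (K i)" "\<And>i. i \<in> I \<Longrightarrow> K i \<subseteq> chart_dom (\<kappa> i)"
    "\<And>i y. i \<in> I \<Longrightarrow> y \<notin> K i \<Longrightarrow> \<phi> i y = 0"
    "\<And>y. y \<in> topspace X \<Longrightarrow> (\<Sum>i\<in>I. \<phi> i y) = 1"
    by (rule partition_of_unity[OF compact]) blast
  have "topspace X \<subseteq> (\<Union>i\<in>I. K i)"
  proof (rule ccontr)
    assume "\<not> topspace X \<subseteq> (\<Union>i\<in>I. K i)"
    then obtain y where y: "y \<in> topspace X" "\<And>i. i \<in> I \<Longrightarrow> y \<notin> K i"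
      by blast
    then have "(\<Sum>i\<in>I. \<phi> i y) = 0"
      using P(6) by (intro sum.neutral) blast
    then show False
      using P(7)[OF y(1)] by simp
  qed
  then have "emeasure \<mu> (space \<mu>) \<le> emeasure \<mu> (\<Union>i\<in>I. K i)"
    using P(1,4) compact_sets by (intro emeasure_mono) (auto simp: space_eq)
  also have "\<dots> \<le> (\<Sum>i\<in>I. emeasure \<mu> (K i))"
    using P(1,4) compact_sets by (intro emeasure_subadditive_finite) auto
  also have "\<dots> < \<infinity>"
    using P emeasure_compact_chart by (simp add: less_top[symmetric]) blast
  finally show "emeasure \<mu> (space \<mu>) \<noteq> \<infinity>"
    by simp
qed

lemma continuous_integrable:
  assumes "continuous_map X euclideanreal f"
  shows "integrable \<mu> f"
proof -
  have "compactin euclideanreal (f ` topspace X)"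
    using compact assms by (intro image_compactin) (auto simp: compact_space_def)
  then have "bounded (f ` topspace X)"
    by (simp add: compact_imp_bounded)
  then obtain B where "\<And>x. x \<in> topspace X \<Longrightarrow> norm (f x) \<le> B"
    by (auto simp: bounded_iff)
  then show ?thesis
    using continuous_measurable[OF assms]
    by (intro finite_measure.integrable_const_bound[OF finite_measure, of _ B]) (auto simp: space_eq)
qed

text \<open>
  In a chart, a nonempty open set has positive Lebesgue measure and the volume density is positive.
\<close>

lemma open_not_null:
  assumes U: "openin X U" "x \<in> U"
  shows "U \<notin> null_sets \<mu>"
proof
  assume null: "U \<in> null_sets \<mu>"
  have "x \<in> topspace X"
    using U openin_subset by blast
  then obtain c where c: "c \<in> A" "x \<in> chart_dom c"
    by (rule chart_around)
  define V where "V = coord c ` (U \<inter> chart_dom c)"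
  have V: "open V" "V \<noteq> {}" "V \<subseteq> chart_codom c"
    using U c open_dom[OF c(1)] coord_in[OF c(1)] by (auto simp: V_def intro!: open_coord_image)
  have U': "U \<inter> chart_dom c \<in> sets \<mu>"
    using U open_dom[OF c(1)] by (intro open_sets) auto
  have "emeasure \<mu> (U \<inter> chart_dom c) = 0"
    using null_sets_subset[OF null U'] by auto
  then have "(\<integral>\<^sup>+y\<in>V. ennreal (sqrt (det (G c y))) \<partial>lborel) = 0"
    using emeasure_chart[OF c(1) U'] by (simp add: V_def)
  moreover have "(\<lambda>y. ennreal (sqrt (det (G c y))) * indicator V y) \<in> borel_measurable lborel"
  proof -
    have "(\<lambda>y. indicator V y *\<^sub>R sqrt (det (G c y))) \<in> borel_measurable borel"
      using V C1_on_continuous[OF volume_density_C1[OF c(1)]]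
      by (intro borel_measurable_continuous_on_indicator) (auto intro: continuous_on_subset)
    then have "(\<lambda>y. ennreal (indicator V y *\<^sub>R sqrt (det (G c y)))) \<in> borel_measurable lborel"
      by simp
    moreover have "(\<lambda>y. ennreal (indicator V y *\<^sub>R sqrt (det (G c y)))) = 
        (\<lambda>y. ennreal (sqrt (det (G c y))) * indicator V y)"
      by (auto simp: indicator_def)
    ultimately show ?thesis by simp
  qed
  ultimately have "AE y in lborel. ennreal (sqrt (det (G c y))) * indicator V y = 0"
    by (simp add: nn_integral_0_iff_AE)
  then have "AE y in lborel. y \<notin> V"
  proof (rule eventually_mono)
    fix y assume "ennreal (sqrt (det (G c y))) * indicator V y = 0"
    then show "y \<notin> V"
      using metric_det_pos[OF c(1), of y] V(3) by (auto simp: indicator_def split: if_splits)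
  qed
  then have "V \<in> null_sets lborel"
    using V(1) by (subst (asm) AE_iff_null_sets[symmetric]) auto
  then have "negligible V"
    by (simp add: negligible_iff_null_sets null_sets_completionI)
  then show False
    using open_not_negligible V by blast
qed

lemma integral_zero_imp_zero:
  assumes f: "continuous_map X euclideanreal f" and nn: "\<And>x. x \<in> topspace X \<Longrightarrow> f x \<ge> 0"
    and 0: "integral\<^sup>L \<mu> f = 0" and x: "x \<in> topspace X"
  shows "f x = 0"
proof (rule ccontr)
  assume "f x \<noteq> 0"
  then have pos: "f x > 0"
    using nn[OF x] by simp
  have "AE y in \<mu>. f y = 0"
    using continuous_integrable[OF f] nn 0
    by (subst integral_nonneg_eq_0_iff_AE[symmetric]) (auto simp: space_eq)
  moreover have U: "openin X {y \<in> topspace X. f y \<in> {0<..}}" (is "openin X ?U")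
    by (intro openin_continuous_map_preimage[OF f]) simp
  ultimately have "AE y in \<mu>. y \<notin> ?U"
    by (auto elim: eventually_mono)
  then have "?U \<in> null_sets \<mu>"
    using open_sets[OF U] by (subst (asm) AE_iff_null_sets[symmetric]) auto
  then show False
    using open_not_null[OF U, of x] x pos by simp
qed

end


section \<open>Gradient inner product\<close>

lemma nabla_sum:
  assumes "\<And>i. i \<in> I \<Longrightarrow> C1_on S (f i)" "x \<in> S"
  shows "nabla (\<lambda>y. \<Sum>i\<in>I. f i y) x = (\<Sum>i\<in>I. nabla (f i) x)"
  using assms
proof (induction I rule: infinite_finite_induct)
  case (insert i I)
  then show ?case
    by (simp add: nabla_add[of S] C1_on_sum)
qed (simp_all add: nabla_const)

text \<open>
  Gradients are covectors and transform with \<open>J\<^sup>T\<close>, while the inverse metric transforms with \<open>J\<^sup>-\<^sup>1\<close> on both sides;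
  the two changes cancel.
\<close>

lemma inverse_metric_transform:
  fixes g g' J :: "real ^ 'p::finite ^ 'p"
  assumes J: "invertible J" and g': "invertible g'" and g: "g = transpose J ** g' ** J"
  shows "(transpose J *v a) \<bullet> (matrix_inv g *v (transpose J *v b)) = a \<bullet> (matrix_inv g' *v b)"
proof -
  let ?K = "matrix_inv J"
  have K: "J ** ?K = mat 1" "?K ** J = mat 1"
    using J by (simp_all add: matrix_inv_right_left)
  have KT: "transpose J ** transpose ?K = mat 1" "transpose ?K ** transpose J = mat 1"
    using K by (simp_all add: matrix_transpose_mul[symmetric])
  have "g ** (?K ** matrix_inv g' ** transpose ?K)
      = transpose J ** (g' ** ((J ** ?K) ** (matrix_inv g' ** transpose ?K)))"
    unfolding g by (simp only: matrix_mul_assoc)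
  also have "\<dots> = transpose J ** ((g' ** matrix_inv g') ** transpose ?K)"
    by (simp only: K matrix_mul_lid matrix_mul_assoc)
  also have "\<dots> = mat 1"
    using g' by (simp add: matrix_inv_right_left KT)
  finally have inv: "matrix_inv g = ?K ** matrix_inv g' ** transpose ?K"
    by (rule matrix_inv_unique)
  have "(transpose J *v a) \<bullet> (matrix_inv g *v (transpose J *v b))
      = a \<bullet> (J *v (matrix_inv g *v (transpose J *v b)))"
    by (metis dot_lmul_matrix vector_transpose_matrix transpose_transpose)
  also have "J *v (matrix_inv g *v (transpose J *v b))
      = (J ** ?K) *v (matrix_inv g' *v ((transpose ?K ** transpose J) *v b))"
    unfolding inv by (simp only: matrix_vector_mul_assoc matrix_mul_assoc)
  finally show ?thesis
    by (simp add: K KT)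
qed

context oriented_riemannian_manifold
begin

lemma nabla_transition:
  assumes c: "c \<in> A" "c' \<in> A" and y: "y \<in> overlap c c'" and u: "C1_manifold A u"
  shows "nabla (u \<circ> param c) y =
    transpose (jacobian (transition c c') (at y)) *v nabla (u \<circ> param c') (transition c c' y)"
proof (rule GDERIV_imp_nabla)
  have "GDERIV (\<lambda>z. (u \<circ> param c') (transition c c' z)) y :>
      transpose (jacobian (transition c c') (at y)) *v nabla (u \<circ> param c') (transition c c' y)"
    by (intro GDERIV_compose_jacobian has_derivative_C1_components[OF transition_C1[OF c] y]
        C1_on_GDERIV[OF C1_manifoldD[OF u c(2)]] transition_in_codom c y)
  then show "GDERIV (u \<circ> param c) y :>
      transpose (jacobian (transition c c') (at y)) *v nabla (u \<circ> param c') (transition c c' y)"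
    by (rule GDERIV_transform_open[OF _ open_overlap[OF c] y]) (simp add: param_transition[OF c])
qed

lemma local_grad_inner_transition:
  assumes c: "c \<in> A" "c' \<in> A" and y: "y \<in> overlap c c'"
    and u: "C1_manifold A u" and v: "C1_manifold A v"
  shows "local_grad_inner (G c) (u \<circ> param c) (v \<circ> param c) y =
    local_grad_inner (G c') (u \<circ> param c') (v \<circ> param c') (transition c c' y)"
proof -
  have "invertible (jacobian (transition c c') (at y))"
    using orientation[OF c y] by (simp add: invertible_det_nz)
  then show ?thesis
    unfolding local_grad_inner_def nabla_transition[OF c y u] nabla_transition[OF c y v]
    by (intro inverse_metric_transform metric_tensorial c y metric_invertible transition_in_codom)
qed

lemma chart_at:
  assumes "x \<in> topspace X"
  shows "chart_at A x \<in> A" "x \<in> chart_dom (chart_at A x)"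
proof -
  have "\<exists>c. c \<in> A \<and> x \<in> chart_dom c"
    using chart_around[OF assms] by metis
  then have "chart_at A x \<in> A \<and> x \<in> chart_dom (chart_at A x)"
    unfolding chart_at_def by (rule someI_ex)
  then show "chart_at A x \<in> A" "x \<in> chart_dom (chart_at A x)"
    by auto
qed

lemma grad_inner_chart:
  assumes c: "c \<in> A" "x \<in> chart_dom c" and u: "C1_manifold A u" and v: "C1_manifold A v"
  shows "grad_inner A G u v x = local_grad_inner (G c) (u \<circ> param c) (v \<circ> param c) (coord c x)"
proof -
  let ?d = "chart_at A x"
  have d: "?d \<in> A" "x \<in> chart_dom ?d"
    using chart_at dom_subset[OF c(1)] c(2) by blast+
  have "coord ?d x \<in> overlap ?d c"
    using c d by (auto simp: overlap_def)
  moreover have "transition ?d c (coord ?d x) = coord c x"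
    using param_coord[OF d] by (simp add: transition_def)
  ultimately show ?thesis
    using local_grad_inner_transition[OF d(1) c(1) _ u v] by (simp add: grad_inner_def Let_def)
qed

lemma grad_inner_continuous:
  assumes u: "C1_manifold A u" and v: "C1_manifold A v"
  shows "continuous_map X euclideanreal (grad_inner A G u v)"
proof (rule continuous_map_charts)
  fix c assume c: "c \<in> A"
  have "continuous_on (chart_codom c) (local_grad_inner (G c) (u \<circ> param c) (v \<circ> param c))"
  proof -
    have "continuous_on (chart_codom c) (\<lambda>y. \<chi> i j. matrix_inv (G c y) $ i $ j)"
      by (intro continuous_on_vec_lambda C1_on_continuous inverse_metric_C1 c)
    then have "continuous_on (chart_codom c) (\<lambda>y. matrix_inv (G c y))"
      by simp
    then show ?thesis
      using C1_on_continuous_nabla[OF C1_manifoldD[OF u c]] C1_on_continuous_nabla[OF C1_manifoldD[OF v c]]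
      unfolding local_grad_inner_def[abs_def] matrix_vector_mult_def
      by (intro continuous_intros continuous_on_vec_lambda)
  qed
  then show "continuous_on (chart_codom c) (grad_inner A G u v \<circ> param c)"
    by (rule continuous_on_eq)
       (simp add: grad_inner_chart[OF c param_in[OF c] u v] coord_param[OF c])
qed

lemma grad_inner_sym:
  assumes "x \<in> topspace X"
  shows "grad_inner A G u v x = grad_inner A G v u x"
proof -
  let ?c = "chart_at A x"
  let ?y = "coord ?c x"
  have c: "?c \<in> A" and y: "?y \<in> chart_codom ?c"
    using chart_at[OF assms] coord_in by blast+
  let ?H = "matrix_inv (G ?c ?y)"
  have "?H ** G ?c ?y = mat 1"
    by (rule matrix_inv_right_left[OF metric_invertible[OF c y]])
  then have "transpose (G ?c ?y) ** transpose ?H = mat 1"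
    by (metis matrix_transpose_mul transpose_mat)
  then have "?H = transpose ?H"
    by (intro matrix_inv_unique) (simp add: metric_symmetric[OF c y])
  then have "a \<bullet> (?H *v b) = b \<bullet> (?H *v a)" for a b
    by (metis dot_lmul_matrix inner_commute vector_transpose_matrix)
  then show ?thesis
    unfolding grad_inner_def local_grad_inner_def Let_def .
qed

lemma grad_inner_sum_left:
  assumes x: "x \<in> topspace X" and f: "\<And>i. i \<in> I \<Longrightarrow> C1_manifold A (f i)"
  shows "grad_inner A G (\<lambda>y. \<Sum>i\<in>I. f i y) v x = (\<Sum>i\<in>I. grad_inner A G (f i) v x)"
proof -
  let ?c = "chart_at A x"
  have "coord ?c x \<in> chart_codom ?c"
    by (rule coord_in[OF chart_at[OF x]])
  then have "nabla (\<lambda>y. \<Sum>i\<in>I. (f i \<circ> param ?c) y) (coord ?c x) = (\<Sum>i\<in>I. nabla (f i \<circ> param ?c) (coord ?c x))"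
    by (intro nabla_sum[of I "chart_codom ?c"] C1_manifoldD[OF f chart_at(1)[OF x]])
  then show ?thesis
    by (simp add: grad_inner_def local_grad_inner_def Let_def comp_def inner_sum_left)
qed

lemma grad_inner_mult_const_left:
  assumes x: "x \<in> topspace X" and f: "C1_manifold A f"
  shows "grad_inner A G (\<lambda>y. k * f y) v x = k * grad_inner A G f v x"
proof -
  let ?c = "chart_at A x"
  have "coord ?c x \<in> chart_codom ?c"
    by (rule coord_in[OF chart_at[OF x]])
  then have "nabla (\<lambda>y. k * (f \<circ> param ?c) y) (coord ?c x) = k *\<^sub>R nabla (f \<circ> param ?c) (coord ?c x)"
    using nabla_mult[OF C1_on_const[of _ k] C1_manifoldD[OF f chart_at(1)[OF x]]] by (simp add: nabla_const)
  then show ?thesis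
    by (simp add: grad_inner_def local_grad_inner_def Let_def comp_def)
qed

lemma grad_inner_linear_left:
  assumes x: "x \<in> topspace X" and f: "\<And>i. i \<in> I \<Longrightarrow> C1_manifold A (f i)"
  shows "grad_inner A G (\<lambda>y. \<Sum>i\<in>I. k i * f i y) v x = (\<Sum>i\<in>I. k i * grad_inner A G (f i) v x)"
proof -
  have "grad_inner A G (\<lambda>y. \<Sum>i\<in>I. k i * f i y) v x = (\<Sum>i\<in>I. grad_inner A G (\<lambda>y. k i * f i y) v x)"
    by (intro grad_inner_sum_left[OF x] C1_manifold_mult C1_manifold_const f)
  also have "\<dots> = (\<Sum>i\<in>I. k i * grad_inner A G (f i) v x)"
    by (intro sum.cong refl grad_inner_mult_const_left[OF x] f)
  finally show ?thesis .
qed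

lemma grad_inner_exp_left:
  assumes x: "x \<in> topspace X" and f: "C1_manifold A f"
  shows "grad_inner A G (\<lambda>y. exp (f y)) v x = exp (f x) * grad_inner A G f v x"
proof -
  let ?c = "chart_at A x"
  have "coord ?c x \<in> chart_codom ?c"
    by (rule coord_in[OF chart_at[OF x]])
  then have "nabla (\<lambda>y. exp ((f \<circ> param ?c) y)) (coord ?c x)
      = exp ((f \<circ> param ?c) (coord ?c x)) *\<^sub>R nabla (f \<circ> param ?c) (coord ?c x)"
    by (rule nabla_exp[OF C1_manifoldD[OF f chart_at(1)[OF x]]])
  then show ?thesis
    by (simp add: grad_inner_def local_grad_inner_def Let_def comp_def param_coord[OF chart_at[OF x]])
qed

lemma grad_inner_cong_left:
  assumes U: "openin X U" "x \<in> U" and eq: "\<And>y. y \<in> U \<Longrightarrow> f y = f' y" and f: "C1_manifold A f"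
  shows "grad_inner A G f v x = grad_inner A G f' v x"
proof -
  have x: "x \<in> topspace X"
    using U openin_subset by blast
  let ?c = "chart_at A x"
  let ?V = "coord ?c ` (U \<inter> chart_dom ?c)"
  note c = chart_at[OF x]
  have "nabla (f' \<circ> param ?c) (coord ?c x) = nabla (f \<circ> param ?c) (coord ?c x)"
  proof (rule nabla_cong_open)
    show "open ?V"
      using U open_dom[OF c(1)] by (intro open_coord_image[OF c(1)]) auto
    show "C1_on ?V (f \<circ> param ?c)"
      by (rule C1_on_subset[OF C1_manifoldD[OF f c(1)]]) (auto simp: coord_in[OF c(1)])
  qed (use U c eq param_coord[OF c(1)] in auto)
  then show ?thesis
    by (simp add: grad_inner_def local_grad_inner_def Let_def)
qed

text \<open>
  The complement of \<open>K\<close> is open, so \<open>f\<close> vanishes near \<open>x\<close> and not only at \<open>x\<close>.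
\<close>

lemma grad_inner_zero_outside:
  assumes K: "compactin X K" and f: "C1_manifold A f" "\<And>y. y \<notin> K \<Longrightarrow> f y = 0"
    and x: "x \<in> topspace X" "x \<notin> K"
  shows "grad_inner A G f v x = 0"
proof -
  have "grad_inner A G (\<lambda>y. 0 * f y) v x = grad_inner A G f v x"
    using openin_diff_compact[OF openin_topspace K] x f
    by (intro grad_inner_cong_left[where U = "topspace X - K"] C1_manifold_mult C1_manifold_const) auto
  then show ?thesis
    using grad_inner_mult_const_left[OF x(1) f(1), of 0] by simp
qed

lemma grad_inner_nonneg:
  assumes "x \<in> topspace X" shows "grad_inner A G u u x \<ge> 0"
proof -
  let ?c = "chart_at A x"
  have c: "?c \<in> A" and y: "coord ?c x \<in> chart_codom ?c"
    using chart_at[OF assms] coord_in by blast+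
  have "a \<bullet> (matrix_inv (G ?c (coord ?c x)) *v a) \<ge> 0" for a
    using positive_definite_inverse[OF metric_positive[OF c y], of a] by (cases "a = 0") auto
  then show ?thesis
    unfolding grad_inner_def local_grad_inner_def Let_def by simp
qed

lemma grad_inner_zero_imp_nabla_zero:
  assumes c: "c \<in> A" "y \<in> chart_codom c" and u: "C1_manifold A u"
    and 0: "grad_inner A G u u (param c y) = 0"
  shows "nabla (u \<circ> param c) y = 0"
proof (rule ccontr)
  assume "nabla (u \<circ> param c) y \<noteq> 0"
  then have "local_grad_inner (G c) (u \<circ> param c) (u \<circ> param c) y > 0"
    unfolding local_grad_inner_def by (intro positive_definite_inverse[OF metric_positive[OF c]])
  then show False
    using 0 by (simp add: grad_inner_chart[OF c(1) param_in[OF c] u u] coord_param[OF c])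
qed

text \<open>
  A level set is closed by continuity, and open because a function with vanishing derivative is constant on
  coordinate balls.
\<close>

lemma locally_constant_imp_constant:
  assumes conn: "connected_space X" and u: "C1_manifold A u"
    and 0: "\<And>x. x \<in> topspace X \<Longrightarrow> grad_inner A G u u x = 0"
  obtains k where "\<And>x. x \<in> topspace X \<Longrightarrow> u x = k"
proof (cases "topspace X = {}")
  case False
  then obtain a where a: "a \<in> topspace X"
    by blast
  define S where "S = {x \<in> topspace X. u x \<in> {u a}}"
  have "closedin X S"
    unfolding S_def by (rule closedin_continuous_map_preimage[OF C1_manifold_continuous[OF u]]) simp
  moreover have "openin X S"
  proof (subst openin_subopen, intro ballI)
    fix x assume "x \<in> S"
    then have x: "x \<in> topspace X" "u x = u a"
      by (auto simp: S_def)
    obtain c where c: "c \<in> A" "x \<in> chart_dom c"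
      using chart_around[OF x(1)] .
    then obtain r where r: "r > 0" "ball (coord c x) r \<subseteq> chart_codom c"
      using coord_in[OF c] open_codom[OF c(1)] open_contains_ball by blast
    have const: "(u \<circ> param c) y = (u \<circ> param c) (coord c x)" if "y \<in> ball (coord c x) r" for y
    proof (rule has_derivative_zero_unique[of "ball (coord c x) r"])
      fix z assume "z \<in> ball (coord c x) r"
      then have z: "z \<in> chart_codom c"
        using r(2) by auto
      then have "nabla (u \<circ> param c) z = 0"
        using param_in[OF c(1) z] dom_subset[OF c(1)]
        by (intro grad_inner_zero_imp_nabla_zero[OF c(1) z u] 0) auto
      then have "((u \<circ> param c) has_derivative (\<lambda>h. 0)) (at z)"
        using C1_on_GDERIV[OF C1_manifoldD[OF u c(1)] z] by (simp add: gderiv_def)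
      then show "((u \<circ> param c) has_derivative (\<lambda>h. 0)) (at z within ball (coord c x) r)"
        by (rule has_derivative_at_withinI)
    qed (use that r(1) in auto)
    show "\<exists>T. openin X T \<and> x \<in> T \<and> T \<subseteq> S"
    proof (intro exI conjI)
      show op: "openin X (param c ` ball (coord c x) r)"
        by (rule open_param_image[OF c(1) _ r(2)]) simp
      show "x \<in> param c ` ball (coord c x) r"
        using r(1) param_coord[OF c] by (intro image_eqI[of x _ "coord c x"]) auto
      show "param c ` ball (coord c x) r \<subseteq> S"
      proof safe
        fix y assume y: "y \<in> ball (coord c x) r"
        then have "u (param c y) = u a"
          using const[OF y] x(2) param_coord[OF c] by simp
        then show "param c y \<in> S"
          using openin_subset[OF op] y by (auto simp: S_def)
      qed
    qed
  qed
  moreover have "a \<in> S"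
    using a by (simp add: S_def)
  ultimately have "S = topspace X"
    using conn[unfolded connected_space_clopen_in, rule_format, of S] by auto
  then show thesis
    using that[of "u a"] by (auto simp: S_def)
qed (use that in auto)

end


section \<open>Green's identity\<close>

context smooth_manifold
begin

lemma Ck_manifold_2_imp_C1:
  assumes "Ck_manifold 2 A u"
  shows "C1_manifold A u" "c \<in> A \<Longrightarrow> C1_on (chart_codom c) (partial j (u \<circ> param c))"
  using assms open_codom Ck_on_2_imp_C1_on
  unfolding Ck_manifold_def C1_manifold_def by blast+

lemma continuous_map_extend_by_zero:
  assumes c: "c \<in> A" and f: "continuous_on (chart_codom c) (f \<circ> param c)"
    and K: "compactin X K" "K \<subseteq> chart_dom c" "\<And>x. x \<in> topspace X \<Longrightarrow> x \<notin> K \<Longrightarrow> f x = 0"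
  shows "continuous_map X euclideanreal f"
  unfolding continuous_map_openin_preimage_eq
proof (intro conjI allI impI)
  fix U :: "real set" assume "openin euclidean U"
  then have "open (chart_codom c \<inter> (f \<circ> param c) -` U)"
    using open_codom[OF c] f by (auto simp: continuous_on_open_vimage Int_commute comp_def)
  then have "openin X (param c ` (chart_codom c \<inter> (f \<circ> param c) -` U))"
    by (intro open_param_image c) auto
  moreover have "param c ` (chart_codom c \<inter> (f \<circ> param c) -` U) = chart_dom c \<inter> f -` U"
    by (subst param_image[OF c]) (auto simp: param_coord[OF c] coord_in[OF c])
  ultimately have 1: "openin X (chart_dom c \<inter> f -` U)"
    by simp
  have 2: "openin X (topspace X - K)"
    by (rule openin_diff_compact[OF openin_topspace K(1)])
  show "openin X (topspace X \<inter> f -` U)"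
  proof (cases "0 \<in> U")
    case True
    then have "topspace X \<inter> f -` U = (chart_dom c \<inter> f -` U) \<union> (topspace X - K)"
      using K dom_subset[OF c] by auto
    then show ?thesis
      using openin_Un[OF 1 2] by simp
  next
    case False
    then have "x \<in> chart_dom c" if "x \<in> topspace X" "f x \<in> U" for x
      using K(2) K(3)[of x] that by (cases "x \<in> K") auto
    then have "topspace X \<inter> f -` U = chart_dom c \<inter> f -` U"
      using dom_subset[OF c] by auto
    then show ?thesis
      using 1 by simp
  qed
qed auto

end

context oriented_riemannian_manifold
begin

definition chart_laplacian :: "('a, 'p) chart \<Rightarrow> ('a \<Rightarrow> real) \<Rightarrow> 'a \<Rightarrow> real" where
  "chart_laplacian c u x = local_laplacian (G c) (u \<circ> param c) (coord c x)"

text \<open>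
  The sum over \<open>j\<close> is the \<open>i\<close>-th component of \<open>(det G)\<^sup>1\<^sup>/\<^sup>2 G\<^sup>-\<^sup>1 \<nabla>u\<close>, the field whose Euclidean
  divergence is \<open>(det G)\<^sup>1\<^sup>/\<^sup>2 \<Delta>u\<close> (\<open>chart_laplacian_param\<close>).
\<close>

definition flux_coeff :: "('a, 'p) chart \<Rightarrow> ('a \<Rightarrow> real) \<Rightarrow> 'p \<Rightarrow> 'p \<Rightarrow> real ^ 'p \<Rightarrow> real" where
  "flux_coeff c u i j y =
    sqrt (det (G c y)) * matrix_inv (G c y) $ i $ j * partial j (u \<circ> param c) y"

lemma flux_coeff_C1:
  assumes "c \<in> A" "Ck_manifold 2 A u"
  shows "C1_on (chart_codom c) (flux_coeff c u i j)"
  unfolding flux_coeff_def[abs_def]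
  by (intro C1_on_mult volume_density_C1 inverse_metric_C1 Ck_manifold_2_imp_C1(2) assms)

lemma chart_laplacian_param:
  assumes "c \<in> A" "y \<in> chart_codom c"
  shows "sqrt (det (G c y)) * chart_laplacian c u (param c y) =
    (\<Sum>i\<in>UNIV. \<Sum>j\<in>UNIV. partial i (flux_coeff c u i j) y)"
  using metric_det_pos[OF assms]
  by (simp add: chart_laplacian_def local_laplacian_def coord_param[OF assms]
      flux_coeff_def[abs_def] sum_divide_distrib[symmetric])

lemma chart_laplacian_continuous:
  assumes c: "c \<in> A" and u: "Ck_manifold 2 A u"
  shows "continuous_on (chart_codom c) (chart_laplacian c u \<circ> param c)"
proof -
  have "continuous_on (chart_codom c)
      (\<lambda>y. (\<Sum>i\<in>UNIV. \<Sum>j\<in>UNIV. partial i (flux_coeff c u i j) y) / sqrt (det (G c y)))"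
    using metric_det_pos[OF c]
    by (intro continuous_on_divide continuous_on_sum C1_on_continuous_partial flux_coeff_C1 c u
        C1_on_continuous volume_density_C1) (auto simp: less_imp_neq[symmetric])
  then show ?thesis
    by (rule continuous_on_eq)
       (use metric_det_pos[OF c] in \<open>simp add: chart_laplacian_param[OF c, symmetric] less_imp_neq[symmetric]\<close>)
qed

lemma chart_laplacian_mult_continuous:
  assumes c: "c \<in> A" and u: "Ck_manifold 2 A u" and \<phi>: "C1_manifold A \<phi>"
    and K: "compactin X K" "K \<subseteq> chart_dom c" "\<And>x. x \<notin> K \<Longrightarrow> \<phi> x = 0"
  shows "continuous_map X euclideanreal (\<lambda>x. \<phi> x * chart_laplacian c u x)"
proof (rule continuous_map_extend_by_zero[OF c _ K(1,2)])
  show "continuous_on (chart_codom c) ((\<lambda>x. \<phi> x * chart_laplacian c u x) \<circ> param c)"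
    using continuous_on_mult[OF C1_on_continuous[OF C1_manifoldD[OF \<phi> c]] chart_laplacian_continuous[OF c u]]
    by (simp add: comp_def)
qed (simp add: K(3))

end

context riemannian_measure
begin

text \<open>
  By the product rule \<open>(det G)\<^sup>1\<^sup>/\<^sup>2 (\<phi> \<Delta>u + \<langle>\<phi>, u\<rangle>)\<close> is in coordinates the divergence of \<open>\<phi>\<close> times the flux of \<open>u\<close>,
  a field with compact support.
\<close>

lemma green_chart:
  assumes c: "c \<in> A" and u: "Ck_manifold 2 A u" and \<phi>: "C1_manifold A \<phi>"
    and K: "compactin X K" "K \<subseteq> chart_dom c" "\<And>x. x \<notin> K \<Longrightarrow> \<phi> x = 0"
  shows "(LINT x|\<mu>. \<phi> x * chart_laplacian c u x + grad_inner A G \<phi> u x) = 0"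
proof -
  let ?f = "\<lambda>x. \<phi> x * chart_laplacian c u x + grad_inner A G \<phi> u x"
  let ?S = "chart_codom c"
  define L where "L = coord c ` K"
  have L: "compact L" "L \<subseteq> ?S"
    using compact_coord_image[OF c K(1,2)] coord_in[OF c] K(2) by (auto simp: L_def)
  have \<phi>L: "\<phi> (param c y) = 0" if "y \<in> ?S" "y \<notin> L" for y
    using K(3)[of "param c y"] coord_param[OF c that(1)] that(2) unfolding L_def by (metis image_eqI)
  have u1: "C1_manifold A u"
    by (rule Ck_manifold_2_imp_C1(1)[OF u])
  \<comment> \<open>extension by zero: outside the chart the coordinate expressions are meaningless\<close>
  define h where "h i j y = (if y \<in> L then \<phi> (param c y) * flux_coeff c u i j y else 0)" for i j y
  have hS: "h i j y = (\<phi> \<circ> param c) y * flux_coeff c u i j y" if "y \<in> ?S" for i j y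
    using \<phi>L[OF that] by (simp add: h_def)
  have prodC1: "C1_on ?S (\<lambda>y. (\<phi> \<circ> param c) y * flux_coeff c u i j y)" for i j
    by (intro C1_on_mult C1_manifoldD[OF \<phi> c] flux_coeff_C1 c u)
  have open_compl: "open (- L)"
    using compact_imp_closed[OF L(1)] by (simp add: open_Compl)
  have h0: "h i j y = 0" if "y \<notin> L" for i j y
    using that by (simp add: h_def)
  have hC1: "C1_on UNIV (h i j)" for i j
  proof -
    have "C1_on ?S (h i j)"
      by (rule C1_on_cong[OF open_codom[OF c] _ prodC1[of i j]]) (simp add: hS)
    moreover have "C1_on (- L) (h i j)"
      by (rule C1_on_cong[OF open_compl _ C1_on_const[of _ 0]]) (simp add: h0)
    moreover have "?S \<union> - L = UNIV"
      using L(2) by auto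
    ultimately show ?thesis
      using C1_on_Un[OF _ _ open_codom[OF c] open_compl] by metis
  qed
  have int0: "integrable lborel (partial i (h i j))" "integral\<^sup>L lborel (partial i (h i j)) = 0" for i j
    using integral_partial_compact_support[OF hC1 L(1) h0] by auto
  have chart_eq: "indicator ?S y * (sqrt (det (G c y)) * ?f (param c y)) =
      (\<Sum>i\<in>UNIV. \<Sum>j\<in>UNIV. partial i (h i j) y)" for y
  proof (cases "y \<in> ?S")
    case True
    let ?r = "sqrt (det (G c y))"
    have "partial i (h i j) y = partial i (\<lambda>y. (\<phi> \<circ> param c) y * flux_coeff c u i j y) y" for i j
      by (rule partial_cong_open[OF open_codom[OF c] True hS])
    also have "\<dots> i j = (\<phi> \<circ> param c) y * partial i (flux_coeff c u i j) y
        + flux_coeff c u i j y * partial i (\<phi> \<circ> param c) y" for i j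
      by (rule partial_mult[OF C1_manifoldD[OF \<phi> c] flux_coeff_C1[OF c u] True])
    finally have "(\<Sum>i\<in>UNIV. \<Sum>j\<in>UNIV. partial i (h i j) y) =
        (\<phi> \<circ> param c) y * (\<Sum>i\<in>UNIV. \<Sum>j\<in>UNIV. partial i (flux_coeff c u i j) y)
        + (\<Sum>i\<in>UNIV. \<Sum>j\<in>UNIV. flux_coeff c u i j y * partial i (\<phi> \<circ> param c) y)"
      by (simp add: sum.distrib sum_distrib_left)
    also have "(\<Sum>i\<in>UNIV. \<Sum>j\<in>UNIV. flux_coeff c u i j y * partial i (\<phi> \<circ> param c) y)
        = ?r * local_grad_inner (G c) (\<phi> \<circ> param c) (u \<circ> param c) y"
      by (simp add: flux_coeff_def local_grad_inner_def nabla_def inner_vec_def matrix_vector_mult_def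
          sum_distrib_left mult_ac)
    also have "(\<Sum>i\<in>UNIV. \<Sum>j\<in>UNIV. partial i (flux_coeff c u i j) y) = ?r * chart_laplacian c u (param c y)"
      by (rule chart_laplacian_param[OF c True, symmetric])
    also have "local_grad_inner (G c) (\<phi> \<circ> param c) (u \<circ> param c) y = grad_inner A G \<phi> u (param c y)"
      by (simp add: grad_inner_chart[OF c param_in[OF c True] \<phi> u1] coord_param[OF c True])
    finally show ?thesis
      using True by (simp add: algebra_simps)
  next
    case False
    then have "y \<in> - L"
      using L(2) by auto
    then have "partial i (h i j) y = partial i (\<lambda>_. 0) y" for i j
      using h0 by (intro partial_cong_open[OF open_compl]) auto
    then show ?thesis
      using False by (simp add: GDERIV_imp_partial[OF GDERIV_const])
  qed
  have "continuous_map X euclideanreal ?f"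
    by (intro continuous_map_add chart_laplacian_mult_continuous[OF c u \<phi> K] grad_inner_continuous \<phi> u1)
  then have "integral\<^sup>L \<mu> ?f = (LINT y|lborel. indicator ?S y * (sqrt (det (G c y)) * ?f (param c y)))"
  proof (intro integral_chart[OF c] continuous_measurable)
    fix x assume x: "x \<in> topspace X" "x \<notin> chart_dom c"
    then have "x \<notin> K"
      using K(2) by auto
    then show "?f x = 0"
      using grad_inner_zero_outside[OF K(1) \<phi> K(3) x(1)] K(3) by simp
  qed
  also have "\<dots> = (LINT y|lborel. (\<Sum>i\<in>UNIV. \<Sum>j\<in>UNIV. partial i (h i j) y))"
    unfolding chart_eq ..
  also have "\<dots> = 0"
    using int0 by (subst Bochner_Integration.integral_sum) (auto intro!: Bochner_Integration.integrable_sum)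
  finally show ?thesis .
qed

text \<open>
  If the inequality failed at \<open>x\<close>, it would fail on an open set around \<open>x\<close>; a bump supported there makes the
  difference of the two coordinate Laplacians integrate to something positive, whereas
  \<open>green_chart\<close> gives both integrals the same value. Exchanging the two charts yields equality.
\<close>

lemma chart_laplacian_le:
  assumes c: "c \<in> A" "c' \<in> A" and x: "x \<in> chart_dom c" "x \<in> chart_dom c'" and u: "Ck_manifold 2 A u"
  shows "chart_laplacian c u x \<le> chart_laplacian c' u x"
proof (rule ccontr)
  assume neg: "\<not> chart_laplacian c u x \<le> chart_laplacian c' u x"
  \<comment> \<open>the second Laplacian is pulled back by the transition map, so that its continuity can be tested in the chart \<open>c\<close>\<close>
  let ?e = "\<lambda>y. chart_laplacian c u (param c y) - chart_laplacian c' u (param c' (transition c c' y))"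
  define V where "V = overlap c c' \<inter> ?e -` {0<..}"
  have sub: "overlap c c' \<subseteq> chart_codom c"
    by (auto simp: overlap_altdef[OF c(1)])
  have trans: "continuous_on (overlap c c') (transition c c')"
    using continuous_on_vec_lambda[of "overlap c c'" "\<lambda>i y. transition c c' y $ i"]
      C1_on_continuous[OF transition_C1[OF c]] by simp
  have "continuous_on (overlap c c') ?e"
    using continuous_on_subset[OF chart_laplacian_continuous[OF c(1) u] sub]
      continuous_on_compose2[OF chart_laplacian_continuous[OF c(2) u] trans] transition_in_codom[OF c]
    by (intro continuous_on_diff) (auto simp: comp_def)
  then have V: "open V"
    unfolding V_def using open_overlap[OF c] by (intro continuous_open_preimage) auto
  have VS: "V \<subseteq> chart_codom c"
    using sub by (auto simp: V_def)
  define U where "U = param c ` V"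
  have U: "openin X U"
    unfolding U_def by (rule open_param_image[OF c(1) V VS])
  have Ue: "z \<in> chart_dom c \<and> z \<in> chart_dom c' \<and> chart_laplacian c' u z < chart_laplacian c u z"
    if z: "z \<in> U" for z
  proof -
    obtain y where "y \<in> V" "z = param c y"
      using z unfolding U_def by blast
    then have y: "y \<in> overlap c c'" "?e y > 0" "z = param c y"
      by (auto simp: V_def)
    then show ?thesis
      using param_transition[OF c y(1)] param_in[OF c(1)] by (auto simp: overlap_altdef[OF c(1)])
  qed
  have ov: "coord c x \<in> overlap c c'"
    using x by (auto simp: overlap_def)
  have "x \<in> U"
    unfolding U_def
  proof (rule image_eqI[of x _ "coord c x"])
    show "coord c x \<in> V"
      using neg ov param_coord[OF c(1) x(1)] param_transition[OF c ov] by (simp add: V_def)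
  qed (simp add: param_coord[OF c(1) x(1)])
  then obtain b K where b: "C1_manifold A b" "\<And>y. b y \<ge> 0" "b x > 0"
      "compactin X K" "K \<subseteq> U" "\<And>y. y \<notin> K \<Longrightarrow> b y = 0"
    using bump_function[OF U] by metis
  have K: "K \<subseteq> chart_dom c" "K \<subseteq> chart_dom c'"
    using b(5) Ue by auto
  note cont = chart_laplacian_mult_continuous[OF c(1) u b(1,4) K(1) b(6)]
    chart_laplacian_mult_continuous[OF c(2) u b(1,4) K(2) b(6)]
    grad_inner_continuous[OF b(1) Ck_manifold_2_imp_C1(1)[OF u]]
  note int = cont[THEN continuous_integrable]
  let ?g = "\<lambda>z. b z * chart_laplacian c u z - b z * chart_laplacian c' u z"
  have g0: "integral\<^sup>L \<mu> ?g = 0"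
    using green_chart[OF c(1) u b(1,4) K(1) b(6)] green_chart[OF c(2) u b(1,4) K(2) b(6)] int by simp
  have gc: "continuous_map X euclideanreal ?g"
    by (intro continuous_map_diff cont)
  have gn: "?g z \<ge> 0" for z
  proof (cases "z \<in> K")
    case True
    then show ?thesis
      using Ue[of z] b(2)[of z] b(5) by (auto intro!: mult_left_mono)
  qed (simp add: b(6))
  have "x \<in> topspace X"
    using dom_subset[OF c(1)] x(1) by auto
  then have "?g x = 0"
    by (rule integral_zero_imp_zero[OF gc gn g0])
  then have "chart_laplacian c u x = chart_laplacian c' u x"
    using b(3) by simp
  then show False
    using neg by simp
qed

lemma laplace_beltrami_chart:
  assumes c: "c \<in> A" "x \<in> chart_dom c" and u: "Ck_manifold 2 A u"
  shows "laplace_beltrami A G u x = chart_laplacian c u x"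
proof -
  have "x \<in> topspace X"
    using dom_subset[OF c(1)] c(2) by auto
  note d = chart_at[OF this]
  have "laplace_beltrami A G u x = chart_laplacian (chart_at A x) u x"
    by (simp add: laplace_beltrami_def chart_laplacian_def Let_def)
  also have "\<dots> = chart_laplacian c u x"
    by (intro antisym chart_laplacian_le c d u)
  finally show ?thesis .
qed

lemma laplace_beltrami_continuous:
  assumes u: "Ck_manifold 2 A u"
  shows "continuous_map X euclideanreal (laplace_beltrami A G u)"
proof (rule continuous_map_charts)
  fix c assume c: "c \<in> A"
  show "continuous_on (chart_codom c) (laplace_beltrami A G u \<circ> param c)"
    by (rule continuous_on_eq[OF chart_laplacian_continuous[OF c u]])
       (simp add: laplace_beltrami_chart[OF c param_in[OF c] u])
qed

theorem green_identity:
  assumes u: "Ck_manifold 2 A u" and \<psi>: "C1_manifold A \<psi>"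
  shows "(LINT x|\<mu>. \<psi> x * laplace_beltrami A G u x) + (LINT x|\<mu>. grad_inner A G \<psi> u x) = 0"
proof -
  obtain I :: "'a set" and \<phi> K \<kappa> where P: "finite I"
    "\<And>i. i \<in> I \<Longrightarrow> C1_manifold A (\<phi> i)" "\<And>i. i \<in> I \<Longrightarrow> \<kappa> i \<in> A"
    "\<And>i. i \<in> I \<Longrightarrow> compactin X (K i)" "\<And>i. i \<in> I \<Longrightarrow> K i \<subseteq> chart_dom (\<kappa> i)"
    "\<And>i y. i \<in> I \<Longrightarrow> y \<notin> K i \<Longrightarrow> \<phi> i y = 0"
    "\<And>y. y \<in> topspace X \<Longrightarrow> (\<Sum>i\<in>I. \<phi> i y) = 1"
    by (rule partition_of_unity[OF compact]) blast
  define \<eta> where "\<eta> i x = \<phi> i x * \<psi> x" for i x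
  have \<eta>: "C1_manifold A (\<eta> i)" if "i \<in> I" for i
    unfolding \<eta>_def by (intro C1_manifold_mult P(2) that \<psi>)
  have \<eta>0: "\<eta> i y = 0" if "i \<in> I" "y \<notin> K i" for i y
    using P(6)[OF that] by (simp add: \<eta>_def)
  have sum_\<eta>: "(\<Sum>i\<in>I. \<eta> i y) = \<psi> y" if "y \<in> topspace X" for y
    using P(7)[OF that] by (simp add: \<eta>_def sum_distrib_right[symmetric])
  have u1: "C1_manifold A u"
    by (rule Ck_manifold_2_imp_C1(1)[OF u])
  let ?F = "\<lambda>\<psi> x. \<psi> x * laplace_beltrami A G u x + grad_inner A G \<psi> u x"
  have int: "integrable \<mu> (\<lambda>x. f x * laplace_beltrami A G u x)" "integrable \<mu> (grad_inner A G f u)"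
    if "C1_manifold A f" for f
    by (intro continuous_integrable continuous_map_real_mult C1_manifold_continuous
        laplace_beltrami_continuous grad_inner_continuous that u u1)+
  have zero: "integral\<^sup>L \<mu> (?F (\<eta> i)) = 0" if i: "i \<in> I" for i
  proof -
    have "integral\<^sup>L \<mu> (?F (\<eta> i)) =
        (LINT x|\<mu>. \<eta> i x * chart_laplacian (\<kappa> i) u x + grad_inner A G (\<eta> i) u x)"
    proof (rule Bochner_Integration.integral_cong)
      fix x
      show "?F (\<eta> i) x = \<eta> i x * chart_laplacian (\<kappa> i) u x + grad_inner A G (\<eta> i) u x"
        using laplace_beltrami_chart[OF P(3)[OF i] _ u, of x] \<eta>0[OF i, of x] P(5)[OF i]
        by (cases "x \<in> K i") auto
    qed simp
    also have "\<dots> = 0"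
      by (rule green_chart[OF P(3)[OF i] u \<eta>[OF i] P(4,5)[OF i]]) (rule \<eta>0[OF i])
    finally show ?thesis .
  qed
  have "integral\<^sup>L \<mu> (?F \<psi>) = (LINT x|\<mu>. (\<Sum>i\<in>I. ?F (\<eta> i) x))"
  proof (rule Bochner_Integration.integral_cong)
    fix x assume "x \<in> space \<mu>"
    then have x: "x \<in> topspace X"
      by (simp add: space_eq)
    have "grad_inner A G \<psi> u x = grad_inner A G (\<lambda>y. \<Sum>i\<in>I. \<eta> i y) u x"
      using sum_\<eta> by (intro grad_inner_cong_left[OF openin_topspace x _ \<psi>]) simp
    also have "\<dots> = (\<Sum>i\<in>I. grad_inner A G (\<eta> i) u x)"
      by (rule grad_inner_sum_left[OF x \<eta>])
    finally show "?F \<psi> x = (\<Sum>i\<in>I. ?F (\<eta> i) x)"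
      using sum_\<eta>[OF x] by (simp add: sum.distrib sum_distrib_right[symmetric])
  qed simp
  also have "\<dots> = (\<Sum>i\<in>I. integral\<^sup>L \<mu> (?F (\<eta> i)))"
    by (intro Bochner_Integration.integral_sum Bochner_Integration.integrable_add int \<eta>)
  also have "\<dots> = 0"
    using zero by simp
  finally show ?thesis
    using int[OF \<psi>] by simp
qed

end


section \<open>Exponential families\<close>

lemma C1_manifold_lincomb:
  assumes "\<And>l. C1_manifold A (\<lambda>x. t x $ l)"
  shows "C1_manifold A (\<lambda>x. b \<bullet> t x)"
  unfolding inner_vec_def inner_real_def
  by (intro C1_manifold_sum C1_manifold_mult C1_manifold_const assms)

context riemannian_measure
begin

lemma exp_expectation_eq:
  assumes t: "\<And>l. C1_manifold A (\<lambda>x. t x $ l)" and h: "continuous_map X euclideanreal h"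
  shows "exp_expectation \<mu> t \<pi> h =
    (LINT x|\<mu>. exp (\<pi> \<bullet> t x) * h x) / (LINT x|\<mu>. exp (\<pi> \<bullet> t x))"
proof -
  let ?Z = "LINT x|\<mu>. exp (\<pi> \<bullet> t x)"
  have w: "(\<lambda>x. exp (\<pi> \<bullet> t x)) \<in> borel_measurable \<mu>"
    by (intro continuous_measurable C1_manifold_continuous C1_manifold_exp C1_manifold_lincomb t)
  have "exp_expectation \<mu> t \<pi> h = (LINT x|\<mu>. exp_density \<mu> t \<pi> x *\<^sub>R h x)"
    unfolding exp_expectation_def
  proof (rule integral_density)
    show "h \<in> borel_measurable \<mu>"
      by (rule continuous_measurable[OF h])
    show "(\<lambda>y. exp_density \<mu> t \<pi> y) \<in> borel_measurable \<mu>"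
      unfolding exp_density_def using w by measurable
    show "AE x in \<mu>. 0 \<le> exp_density \<mu> t \<pi> x"
      by (simp add: exp_density_def)
  qed
  also have "\<dots> = (LINT x|\<mu>. (exp (\<pi> \<bullet> t x) * h x) / ?Z)"
    by (simp add: exp_density_def)
  finally show ?thesis
    by simp
qed

lemma integral_positive:
  assumes f: "continuous_map X euclideanreal f" "\<And>x. x \<in> topspace X \<Longrightarrow> f x \<ge> 0"
    and x: "x \<in> topspace X" "f x > 0"
  shows "integral\<^sup>L \<mu> f > 0"
proof -
  have "integral\<^sup>L \<mu> f \<ge> 0"
    using f(2) by (intro Bochner_Integration.integral_nonneg) (simp add: space_eq)
  moreover have "integral\<^sup>L \<mu> f \<noteq> 0"
    using integral_zero_imp_zero[OF f _ x(1)] x(2) by auto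
  ultimately show ?thesis
    by simp
qed

lemma grad_inner_lincomb:
  assumes x: "x \<in> topspace X" and t: "\<And>l. C1_manifold A (\<lambda>x. t x $ l)"
  shows "grad_inner A G (\<lambda>y. b \<bullet> t y) v x = (\<Sum>l\<in>UNIV. b $ l * grad_inner A G (\<lambda>y. t y $ l) v x)"
  unfolding inner_vec_def inner_real_def by (rule grad_inner_linear_left[OF x t])

end

lemma lin_indep_funs_const_imp_zero:
  assumes li: "lin_indep_funs S (case_option (\<lambda>_. 1) (\<lambda>l x. t x $ l))"
    and const: "\<And>x. x \<in> S \<Longrightarrow> b \<bullet> t x = k"
  shows "b = 0"
proof -
  \<comment> \<open>coefficient \<open>- k\<close> for the constant function 1, which has index \<open>None\<close>\<close>
  let ?b = "case_option (- k) (\<lambda>l. b $ l)"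
  let ?h = "case_option (\<lambda>_. 1) (\<lambda>l x. t x $ l)"
  have "(\<Sum>i\<in>UNIV. ?b i * ?h i x) = 0" if "x \<in> S" for x
  proof -
    have "(\<Sum>i\<in>UNIV. ?b i * ?h i x) = - k + (\<Sum>l\<in>UNIV. b $ l * t x $ l)"
      by (simp add: UNIV_option_conv sum.reindex)
    then show ?thesis
      using const[OF that] by (simp add: inner_vec_def)
  qed
  then have "\<forall>i. ?b i = 0"
    using li[unfolded lin_indep_funs_def, rule_format, of ?b] by blast
  then have "?b (Some l) = 0" for l
    by blast
  then show ?thesis
    by (simp add: vec_eq_iff)
qed

lemma lin_indep_funs_nonempty:
  assumes "lin_indep_funs S h" shows "S \<noteq> {}"
  using assms[unfolded lin_indep_funs_def, rule_format, of "\<lambda>_. 1"] by auto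

theorem mainTheorem2:
  fixes X :: "'a topology"
    and A :: "('a, 'p::finite) chart set"
    and G :: "('a, 'p) chart \<Rightarrow> real ^ 'p \<Rightarrow> real ^ 'p ^ 'p"
    and \<mu> :: "'a measure"
    and t :: "'a \<Rightarrow> real ^ 'm::finite"
    and \<pi>0 :: "real ^ 'm"
    and W :: "real ^ 'm ^ 'm"
    and d :: "real ^ 'm"
  assumes "compact_oriented_riemannian_manifold X A G"
    and "connected_space X"
    and "uniform_measure_on X A G \<mu>"
    and "\<And>l. Ck_manifold 2 A (\<lambda>x. t x $ l)"
    and "lin_indep_funs (topspace X) (case_option (\<lambda>_. 1) (\<lambda>l x. t x $ l))"
    and "W = (\<chi> l1 l2. exp_expectation \<mu> t \<pi>0
                (grad_inner A G (\<lambda>x. t x $ l1) (\<lambda>x. t x $ l2)))"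
    and "d = (\<chi> l. - exp_expectation \<mu> t \<pi>0 (laplace_beltrami A G (\<lambda>x. t x $ l)))"
  shows "invertible W \<and> \<pi>0 = matrix_inv W *v d"
proof -
  interpret riemannian_measure X A G \<mu>
    using assms(1,3) by (simp add: riemannian_measure_def riemannian_measure_axioms_def)
  note t2 = assms(4)
  have t1: "C1_manifold A (\<lambda>x. t x $ l)" for l
    by (rule Ck_manifold_2_imp_C1(1)[OF t2])
  have v1: "C1_manifold A (\<lambda>x. b \<bullet> t x)" for b
    by (rule C1_manifold_lincomb[OF t1])
  define w where "w x = exp (\<pi>0 \<bullet> t x)" for x
  define Z where "Z = integral\<^sup>L \<mu> w"
  \<comment> \<open>the expectation of \<open>\<langle>u, v\<rangle>\<close> multiplied by the normalising constant \<open>Z\<close>\<close>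
  define B where "B u v = (LINT x|\<mu>. w x * grad_inner A G u v x)" for u v
  have w1: "C1_manifold A w"
    unfolding w_def by (rule C1_manifold_exp[OF v1])
  have contB: "continuous_map X euclideanreal (\<lambda>x. w x * grad_inner A G u v x)"
    if "C1_manifold A u" "C1_manifold A v" for u v
    by (intro continuous_map_real_mult C1_manifold_continuous w1 grad_inner_continuous that)
  obtain x0 where x0: "x0 \<in> topspace X"
    using lin_indep_funs_nonempty[OF assms(5)] by blast
  have Z: "Z > 0"
    unfolding Z_def by (rule integral_positive[OF C1_manifold_continuous[OF w1] _ x0]) (simp_all add: w_def)
  have W: "W $ k $ l = B (\<lambda>x. t x $ k) (\<lambda>x. t x $ l) / Z" for k l
    unfolding assms(6) B_def Z_def w_def
    by (simp add: exp_expectation_eq[OF t1 grad_inner_continuous[OF t1 t1]])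
  have d: "d $ l = - (LINT x|\<mu>. w x * laplace_beltrami A G (\<lambda>x. t x $ l) x) / Z" for l
    unfolding assms(7) Z_def w_def
    by (simp add: exp_expectation_eq[OF t1 laplace_beltrami_continuous[OF t2]])
  have B_sym: "B u v = B v u" for u v
    unfolding B_def by (intro Bochner_Integration.integral_cong) (simp_all add: space_eq grad_inner_sym)
  have B_lincomb: "B (\<lambda>x. b \<bullet> t x) v = (\<Sum>k\<in>UNIV. b $ k * B (\<lambda>x. t x $ k) v)"
    if v: "C1_manifold A v" for b v
  proof -
    have "B (\<lambda>x. b \<bullet> t x) v = (LINT x|\<mu>. (\<Sum>k\<in>UNIV. b $ k * (w x * grad_inner A G (\<lambda>x. t x $ k) v x)))"
      unfolding B_def
      by (intro Bochner_Integration.integral_cong)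
         (simp_all add: space_eq grad_inner_lincomb[OF _ t1] sum_distrib_left mult_ac)
    also have "\<dots> = (\<Sum>k\<in>UNIV. b $ k * B (\<lambda>x. t x $ k) v)"
      unfolding B_def using continuous_integrable[OF contB[OF t1 v]]
      by (subst Bochner_Integration.integral_sum) auto
    finally show ?thesis .
  qed
  have Wb: "(W *v b) $ l = B (\<lambda>x. b \<bullet> t x) (\<lambda>x. t x $ l) / Z" for b l
    using B_sym[of "\<lambda>x. t x $ l"]
    by (simp add: matrix_vector_mult_def W B_lincomb[OF t1] sum_divide_distrib mult_ac)
  have quadratic: "b \<bullet> (W *v b) = B (\<lambda>x. b \<bullet> t x) (\<lambda>x. b \<bullet> t x) / Z" for b
    using B_sym[of "\<lambda>x. b \<bullet> t x"]
    by (simp add: inner_vec_def[of b "W *v b"] Wb B_lincomb[OF v1] sum_divide_distrib)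
  have "b \<bullet> (W *v b) > 0" if b: "b \<noteq> 0" for b
  proof -
    let ?v = "\<lambda>x. b \<bullet> t x"
    have "\<exists>x\<in>topspace X. grad_inner A G ?v ?v x \<noteq> 0"
    proof (rule ccontr)
      assume "\<not> ?thesis"
      then obtain k where "\<And>x. x \<in> topspace X \<Longrightarrow> ?v x = k"
        using locally_constant_imp_constant[OF assms(2) v1] by metis
      then show False
        using lin_indep_funs_const_imp_zero[OF assms(5)] b by blast
    qed
    then obtain x where x: "x \<in> topspace X" "grad_inner A G ?v ?v x > 0"
      using grad_inner_nonneg[of _ ?v] by (metis order_le_less)
    have "B ?v ?v > 0"
      unfolding B_def
      by (rule integral_positive[OF contB[OF v1 v1] _ x(1)])
         (use x grad_inner_nonneg in \<open>auto simp: w_def\<close>)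
    then show ?thesis
      using Z by (simp add: quadratic)
  qed
  then have inv: "invertible W"
    by (rule positive_definite_invertible)
  have "(W *v \<pi>0) $ l = d $ l" for l
  proof -
    have "B (\<lambda>x. \<pi>0 \<bullet> t x) (\<lambda>x. t x $ l) = (LINT x|\<mu>. grad_inner A G w (\<lambda>x. t x $ l) x)"
      unfolding B_def w_def
      by (intro Bochner_Integration.integral_cong) (simp_all add: space_eq grad_inner_exp_left[OF _ v1])
    also have "\<dots> = - (LINT x|\<mu>. w x * laplace_beltrami A G (\<lambda>x. t x $ l) x)"
      using green_identity[OF t2 w1] by (simp add: eq_neg_iff_add_eq_0 add.commute)
    finally show ?thesis
      by (simp add: Wb d)
  qed
  then have "W *v \<pi>0 = d"
    by (simp add: vec_eq_iff)
  then have "matrix_inv W *v d = \<pi>0"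
    by (metis inv matrix_inv_right_left(2) matrix_vector_mul_assoc matrix_vector_mul_lid)
  then show ?thesis
    using inv by simp
qed

end
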